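(* There is an absolute constant $c>0$ such that the following holds. Let $k\ge 2$, $n\ge 1$, and $s_1,\ldots,s_k\ge 1$ be integers with $\sum_{i} s_i\le n/2$. Let $\Pi$ be a (public-coin, possibly also private-coin) randomized $k$-party $[c_1,\ldots,c_k]$-bounded protocol which solves the $[s_1,\ldots,s_k]$-size $k$-party unique set-disjointness problem with error at most $1\%$ on every input, i.e. for every $X\in \mathcal{F}_b\cap\{X:|X_i|=s_i\ \forall i\}$, $b\in\{0,1\}$, it outputs $b$ with probability at least $0.99$. Then $$\sum_{i\in[k]}\frac{c_i}{s_i}\ \ge\ c.$$
   Context: Identify $Y\in\{0,1\}^n$ with the set $\{j:Y(j)=1\}$ and write $|Y|$ for its size. An input is $X=(X_1,\ldots,X_k)\in(\{0,1\}^n)^k$, player $i$ holding $X_i$. For $j\in[n]$ let $X^j=(X_1(j),\ldots,X_k(j))\in\{0,1\}^k$ and $|X^j|$ its Hamming weight. Define $\mathcal{F}_0=\{X:\forall j,\ |X^j|\le 1\}$ (pairwise disjoint sets) and $\mathcal{F}_1=\{X:\exists j,\ |X^j|=k,\ \forall j'\neq j,\ |X^{j'}|\le 1\}$ (unique common element). On inputs in $\mathcal{F}_b$ the correct output is $b$. Protocols are in the blackboard model: at each step a player determined by the current transcript writes one bit (depending on its input, the transcript and randomness) on a common board; the output bit is determined by the transcript. A protocol is $[c_1,\ldots,c_k]$-bounded if in every transcript player $i$ writes at most $c_i$ bits. The $[s_1,\ldots,s_k]$-size problem is the restriction to inputs with $|X_i|=s_i$ for all $i$. *)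

theory Defs
  imports "HOL-Probability.Probability"
begin

text \<open>Deterministic blackboard protocols as binary trees. At an inner node
  the player \<open>i\<close> (determined by the position, i.e. by the transcript so far)
  writes one bit computed from its own input \<open>X i\<close>; the bit chooses the
  subtree. A leaf carries the output bit.\<close>

datatype protocol = Leaf bool | Node nat "nat set \<Rightarrow> bool" protocol protocol

fun run :: "protocol \<Rightarrow> (nat \<Rightarrow> nat set) \<Rightarrow> bool" where
  "run (Leaf b) X = b"
| "run (Node i f t1 t0) X = (if f (X i) then run t1 X else run t0 X)"

fun bounded :: "nat \<Rightarrow> (nat \<Rightarrow> nat) \<Rightarrow> protocol \<Rightarrow> bool" where
  "bounded k c (Leaf b) = True"
| "bounded k c (Node i f t1 t0) =
     (i < k \<and> 1 \<le> c i \<and> bounded k (c(i := c i - 1)) t1 \<and> bounded k (c(i := c i - 1)) t0)"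

definition colweight :: "nat \<Rightarrow> (nat \<Rightarrow> nat set) \<Rightarrow> nat \<Rightarrow> nat" where
  "colweight k X j = card {i. i < k \<and> j \<in> X i}"

definition valid_input :: "nat \<Rightarrow> nat \<Rightarrow> (nat \<Rightarrow> nat set) \<Rightarrow> bool" where
  "valid_input k n X \<longleftrightarrow> (\<forall>i<k. X i \<subseteq> {0..<n})"

definition F0 :: "nat \<Rightarrow> nat \<Rightarrow> (nat \<Rightarrow> nat set) set" where
  "F0 k n = {X. valid_input k n X \<and> (\<forall>j<n. colweight k X j \<le> 1)}"

definition F1 :: "nat \<Rightarrow> nat \<Rightarrow> (nat \<Rightarrow> nat set) set" where
  "F1 k n = {X. valid_input k n X \<and>
     (\<exists>j<n. colweight k X j = k \<and> (\<forall>j'<n. j' \<noteq> j \<longrightarrow> colweight k X j' \<le> 1))}"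

definition sized :: "nat \<Rightarrow> (nat \<Rightarrow> nat) \<Rightarrow> (nat \<Rightarrow> nat set) \<Rightarrow> bool" where
  "sized k s X \<longleftrightarrow> (\<forall>i<k. card (X i) = s i)"

text \<open>A randomized protocol is a probability distribution over deterministic
  protocols (public coins; private coins can be fixed in advance). It solves
  the size-restricted unique disjointness problem with error at most 1%.\<close>
definition solves_UDISJ ::
  "nat \<Rightarrow> nat \<Rightarrow> (nat \<Rightarrow> nat) \<Rightarrow> protocol pmf \<Rightarrow> bool" where
  "solves_UDISJ k n s P \<longleftrightarrow>
     (\<forall>X. sized k s X \<longrightarrow>
        (X \<in> F0 k n \<longrightarrow> measure_pmf.prob P {t. run t X = False} \<ge> 99/100) \<and>
        (X \<in> F1 k n \<longrightarrow> measure_pmf.prob P {t. run t X = True} \<ge> 99/100))"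

definition bounded_randomized :: "nat \<Rightarrow> (nat \<Rightarrow> nat) \<Rightarrow> protocol pmf \<Rightarrow> bool" where
  "bounded_randomized k c P \<longleftrightarrow> (\<forall>t\<in>set_pmf P. bounded k c t)"

end

(*
  Hard inputs: disjoint sets S_i with |S_i| = 2 s_i - 1 and an element j outside all of them. Given
  (S, j), player i holds a random s_i-subset of S_i (answer 0), or of S_i + j containing j (answer 1).
  For a transcript tau of a deterministic protocol both probabilities factor over the players.
  Let f_i be the probability that the i-th set avoids j, given that it is an s_i-subset of S_i + j
  consistent with tau. Then Pr_1(tau) / Pr_0(tau) is the product of the (1 - f_i) / f_i, whose
  logarithm is about -2 Z, where Z = sum_i ln (2 f_i).

  The expectation of Z under Pr_0 is additive over the players. Since j is uniform in S_i + j given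
  everything else, player i contributes at most c_i / s_i: for a family R of s-subsets of a 2s-set W,
  with t_a the proportion of members of R avoiding a, Jensen and Maclaurin's inequality for the
  elementary symmetric polynomials give sum_a t_a ln (2 t_a) <= ln (binomial (2s) s / |R|). Because
  the t_a have mean 1/2, the same quantity bounds the sum of (t_a - 1/2)^2. Hence, if
  sum_i c_i / s_i is small, most transcripts of Pr_0 are almost as likely under Pr_1, and the
  protocol errs.
*)
theory Submission
  imports Defs
begin

section \<open>Entropy deficiency of families of sets of fixed size\<close>

definition slice :: "'a set \<Rightarrow> nat \<Rightarrow> 'a set set" where
  "slice W m = {Y. Y \<subseteq> W \<and> card Y = m}"

lemma finite_slice [simp]: "finite W \<Longrightarrow> finite (slice W m)"
  unfolding slice_def by simp

lemma card_slice: "finite W \<Longrightarrow> card (slice W m) = card W choose m"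
  unfolding slice_def by (rule n_subsets)

lemma slice_insert_Suc:
  assumes "finite V" "a \<notin> V"
  shows "slice (insert a V) (Suc m) = slice V (Suc m) \<union> insert a ` slice V m"
proof (intro equalityI subsetI)
  fix Y assume Y: "Y \<in> slice (insert a V) (Suc m)"
  show "Y \<in> slice V (Suc m) \<union> insert a ` slice V m"
  proof (cases "a \<in> Y")
    case True
    have "Y - {a} \<in> slice V m" using Y True unfolding slice_def by auto
    then show ?thesis using True by (metis UnI2 image_eqI insert_Diff)
  next
    case False
    then show ?thesis using Y unfolding slice_def by auto
  qed
next
  fix Y assume "Y \<in> slice V (Suc m) \<union> insert a ` slice V m"
  then show "Y \<in> slice (insert a V) (Suc m)"
  proof
    assume "Y \<in> insert a ` slice V m"
    then obtain Z where Z: "Y = insert a Z" "Z \<subseteq> V" "card Z = m" unfolding slice_def by blast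
    then have "finite Z" "a \<notin> Z" using assms by (auto intro: finite_subset)
    then show ?thesis using Z unfolding slice_def by auto
  qed (auto simp: slice_def)
qed

definition esym :: "('a \<Rightarrow> real) \<Rightarrow> 'a set \<Rightarrow> nat \<Rightarrow> real" where
  "esym w V m = (\<Sum>Y\<in>slice V m. \<Prod>a\<in>Y. w a)"

lemma esym_0: "finite V \<Longrightarrow> esym w V 0 = 1"
proof -
  assume "finite V"
  then have "slice V 0 = {{}}"
    unfolding slice_def by (auto dest: finite_subset)
  then show ?thesis unfolding esym_def by simp
qed

lemma esym_insert_Suc:
  assumes "finite V" "a \<notin> V"
  shows "esym w (insert a V) (Suc m) = esym w V (Suc m) + w a * esym w V m"
proof -
  have inj: "inj_on (insert a) (slice V m)"
    using assms(2) unfolding slice_def by (auto simp: inj_on_def)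
  have disj: "slice V (Suc m) \<inter> insert a ` slice V m = {}"
    using assms(2) unfolding slice_def by auto
  have "(\<Sum>Y\<in>insert a ` slice V m. \<Prod>a\<in>Y. w a) = (\<Sum>Y\<in>slice V m. \<Prod>b\<in>insert a Y. w b)"
    by (simp add: sum.reindex[OF inj])
  also have "\<dots> = (\<Sum>Y\<in>slice V m. w a * (\<Prod>b\<in>Y. w b))"
  proof (rule sum.cong[OF refl])
    fix Y assume "Y \<in> slice V m"
    then have "finite Y" "a \<notin> Y"
      using assms unfolding slice_def by (auto dest: finite_subset)
    then show "(\<Prod>b\<in>insert a Y. w b) = w a * (\<Prod>b\<in>Y. w b)" by simp
  qed
  finally show ?thesis
    using assms disj unfolding esym_def slice_insert_Suc[OF assms]
    by (simp add: sum.union_disjoint sum_distrib_left)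
qed

lemma esym_cong: "(\<And>x. x \<in> V \<Longrightarrow> w x = w' x) \<Longrightarrow> esym w V m = esym w' V m"
  unfolding esym_def slice_def by (intro sum.cong prod.cong) auto

lemma esym_nonneg: "(\<And>x. x \<in> V \<Longrightarrow> 0 \<le> w x) \<Longrightarrow> 0 \<le> esym w V m"
  unfolding esym_def slice_def by (intro sum_nonneg prod_nonneg) auto

text \<open>Expanded in the weights of \<open>a\<close> and \<open>b\<close>, the polynomial is e_m
  + (w a + w b) e_(m-1) + (w a * w b) e_(m-2), with the e's taken over \<open>V\<close>. With the
  sum of the two weights fixed only the last term changes, and its coefficient is
  nonnegative.\<close>

lemma esym_smooth:
  assumes "finite V" "a \<noteq> b" "a \<notin> V" "b \<notin> V"
    and nonneg: "\<And>x. x \<in> V \<Longrightarrow> 0 \<le> w x" and eq: "\<And>x. x \<in> V \<Longrightarrow> w x = w' x"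
    and sum: "w a + w b = w' a + w' b" and prod: "w a * w b \<le> w' a * w' b"
  shows "esym w (insert a (insert b V)) m \<le> esym w' (insert a (insert b V)) m"
proof -
  have E: "esym w' V l = esym w V l" for l
    using esym_cong[of V w w'] eq by simp
  consider "m = 0" | "m = Suc 0" | l where "m = Suc (Suc l)"
    by (metis not0_implies_Suc)
  then show ?thesis
  proof cases
    case 1
    then show ?thesis using assms(1) by (simp add: esym_0)
  next
    case 2
    then show ?thesis using assms(1-4) sum by (simp add: esym_insert_Suc esym_0 E)
  next
    case 3
    have "esym u (insert a (insert b V)) m
        = esym u V (Suc (Suc l)) + (u a + u b) * esym u V (Suc l) + (u a * u b) * esym u V l" for u
      using 3 assms(1-4) by (simp add: esym_insert_Suc algebra_simps)
    then show ?thesis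
      using mult_right_mono[OF prod esym_nonneg[of V w l, OF nonneg]] sum by (simp add: E)
  qed
qed

text \<open>Maclaurin's inequality for weights of mean 1, by smoothing. As long as some weight
  differs from 1, there is one below 1 and one above 1. Moving the former to 1 and compensating at
  the latter does not decrease the polynomial and leaves fewer weights different from 1.\<close>

theorem esym_maclaurin:
  assumes "finite W" "\<And>x. x \<in> W \<Longrightarrow> 0 \<le> w x" "sum w W = real (card W)"
  shows "esym w W m \<le> real (card W choose m)"
  using assms(2,3)
proof (induction "card {x \<in> W. w x \<noteq> 1}" arbitrary: w rule: less_induct)
  case less
  show ?case
  proof (cases "\<forall>x\<in>W. w x = 1")
    case True
    then have "esym w W m = esym (\<lambda>_. 1) W m" by (intro esym_cong) auto
    also have "\<dots> = real (card W choose m)"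
      using assms(1) unfolding esym_def by (simp add: card_slice)
    finally show ?thesis by simp
  next
    case False
    have sum0: "(\<Sum>x\<in>W. w x - 1) = 0" using less.prems by (simp add: sum_subtractf)
    have "\<exists>a\<in>W. w a < 1"
    proof (rule ccontr)
      assume "\<not> ?thesis"
      then have "\<forall>x\<in>W. w x - 1 = 0"
        using sum0 sum_nonneg_eq_0_iff[OF assms(1), of "\<lambda>x. w x - 1"] by (simp add: not_less)
      with False show False by simp
    qed
    then obtain a where a: "a \<in> W" "w a < 1" by blast
    have "\<exists>b\<in>W. w b > 1"
    proof (rule ccontr)
      assume "\<not> ?thesis"
      then have "\<forall>x\<in>W. 1 - w x = 0"
        using sum0 sum_nonneg_eq_0_iff[OF assms(1), of "\<lambda>x. 1 - w x"]
        by (simp add: not_less sum_subtractf)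
      with False show False by simp
    qed
    then obtain b where b: "b \<in> W" "w b > 1" by blast
    have ab: "a \<noteq> b" using a b by auto
    define V where "V = W - {a, b}"
    have W: "W = insert a (insert b V)" "a \<notin> V" "b \<notin> V" "finite V"
      using a b assms(1) unfolding V_def by auto
    \<comment> \<open>The product of the two weights grows by exactly (1 - w a) * (w b - 1), and the
      compensated weight w a + w b - 1 is nonnegative because w b > 1.\<close>
    define w' where "w' = w(a := 1, b := w a + w b - 1)"
    have "0 \<le> (1 - w a) * (w b - 1)" using a b by simp
    then have pr: "w a * w b \<le> w' a * w' b" using ab unfolding w'_def by (simp add: algebra_simps)
    have "esym w W m \<le> esym w' W m"
      unfolding W(1)
      by (rule esym_smooth) (use W ab pr less.prems(1) in \<open>auto simp: w'_def\<close>)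
    also have "\<dots> \<le> real (card W choose m)"
    proof (rule less.hyps)
      show "card {x \<in> W. w' x \<noteq> 1} < card {x \<in> W. w x \<noteq> 1}"
      proof (rule psubset_card_mono)
        have "a \<in> {x \<in> W. w x \<noteq> 1}" "a \<notin> {x \<in> W. w' x \<noteq> 1}" using a ab by (auto simp: w'_def)
        moreover have "{x \<in> W. w' x \<noteq> 1} \<subseteq> {x \<in> W. w x \<noteq> 1}"
          using b by (auto simp: w'_def split: if_splits)
        ultimately show "{x \<in> W. w' x \<noteq> 1} \<subset> {x \<in> W. w x \<noteq> 1}" by blast
      qed (use assms(1) in simp)
      show "0 \<le> w' x" if "x \<in> W" for x
        using less.prems(1)[OF that] less.prems(1)[OF a(1)] b unfolding w'_def by auto
      have "sum w' V = sum w V" by (rule sum.cong) (use W in \<open>auto simp: w'_def\<close>)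
      then show "sum w' W = real (card W)"
        using less.prems(2) W ab unfolding W(1) by (simp add: w'_def)
    qed
    finally show ?thesis .
  qed
qed

section \<open>Entropy bounds for one family in the middle slice, then for a partition of it\<close>

lemma slice_complement:
  assumes "finite W" "card W = m + l"
  shows "bij_betw (\<lambda>Y. W - Y) (slice W m) (slice W l)"
  by (rule bij_betw_byWitness[where f' = "\<lambda>Y. W - Y"])
    (use assms in \<open>auto simp: slice_def card_Diff_subset finite_subset[of _ W] double_diff\<close>)

text \<open>For \<open>Y\<close> uniform in \<open>R\<close>, the logarithm of the product of 2 t_a
  over a in W - Y has mean K, the left-hand side of the first bound. By Jensen the product itself
  has mean at least exp K. Being nonnegative, it can be summed over the whole slice, where
  Maclaurin's inequality bounds the sum by the size of the slice. Elements with t_a = 0 contribute 0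
  to K whatever \<open>ln 0\<close> is, and they lie in every member of \<open>R\<close>.\<close>

lemma slice_entropy:
  assumes "finite W" and card_W: "card W = 2 * m" and R: "R \<subseteq> slice W m" "R \<noteq> {}"
    and t: "\<And>a. t a = real (card {Y \<in> R. a \<notin> Y}) / real (card R)"
  shows "(\<Sum>a\<in>W. t a * ln (2 * t a)) \<le> ln (real (card (slice W m)) / real (card R))"
    and "(\<Sum>a\<in>W. t a) = real m"
proof -
  have finR: "finite R" using R(1) assms(1) by (meson finite_slice finite_subset)
  then have cR: "card R > 0" using R(2) by (simp add: card_gt_0_iff)
  have weighted: "(\<Sum>Y\<in>R. \<Sum>a\<in>W - Y. f a) = real (card R) * (\<Sum>a\<in>W. t a * f a)" for f :: "_ \<Rightarrow> real"
  proof -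
    have "(\<Sum>Y\<in>R. \<Sum>a\<in>W - Y. f a) = (\<Sum>Y\<in>R. \<Sum>a\<in>W. if a \<notin> Y then f a else 0)"
      using assms(1) by (intro sum.cong refl sum.mono_neutral_cong_left) auto
    also have "\<dots> = (\<Sum>a\<in>W. \<Sum>Y\<in>R. if a \<notin> Y then f a else 0)" by (rule sum.swap)
    also have "\<dots> = (\<Sum>a\<in>W. real (card {Y \<in> R. a \<notin> Y}) * f a)"
      using finR by (intro sum.cong refl) (simp flip: sum.inter_filter)
    also have "\<dots> = real (card R) * (\<Sum>a\<in>W. t a * f a)"
      using cR by (simp add: t sum_distrib_left)
    finally show ?thesis .
  qed
  have cY: "card (W - Y) = m" if "Y \<in> R" for Y
  proof -
    have "Y \<subseteq> W" "card Y = m" using that R(1) unfolding slice_def by auto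
    then show ?thesis using assms(1) card_W by (simp add: card_Diff_subset finite_subset[of _ W])
  qed
  have "(\<Sum>Y\<in>R. \<Sum>a\<in>W - Y. (1::real)) = real (card R) * real m" using cY by simp
  with weighted[of "\<lambda>_. 1"] show sum_t: "(\<Sum>a\<in>W. t a) = real m" using cR by simp
  define K where "K = (\<Sum>a\<in>W. t a * ln (2 * t a))"
  \<comment> \<open>Complementation maps the middle slice to itself, so this sum is an elementary
    symmetric polynomial. The weights 2 t_a have mean 1, since the t_a add up to m and
    \<open>W\<close> has 2m elements.\<close>
  have mac: "(\<Sum>Y\<in>slice W m. \<Prod>a\<in>W - Y. 2 * t a) \<le> real (card (slice W m))"
  proof -
    have "(\<Sum>Y\<in>slice W m. \<Prod>a\<in>W - Y. 2 * t a) = esym (\<lambda>a. 2 * t a) W m"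
      unfolding esym_def using slice_complement[of W m m] assms(1) card_W
      by (intro sum.reindex_bij_betw) auto
    also have "\<dots> \<le> real (card W choose m)"
    proof (rule esym_maclaurin)
      show "(\<Sum>a\<in>W. 2 * t a) = real (card W)"
        using sum_t card_W by (simp only: sum_distrib_left[symmetric])
    qed (use assms(1) in \<open>simp_all add: t\<close>)
    finally show ?thesis using assms(1) by (simp add: card_slice)
  qed
  \<comment> \<open>Jensen in tangent form: the deviations from the mean K cancel over
    \<open>R\<close>, and 1 + x is then replaced by exp x.\<close>
  have "real (card R) = (\<Sum>Y\<in>R. 1 + ((\<Sum>a\<in>W - Y. ln (2 * t a)) - K))"
    unfolding sum.distrib sum_subtractf weighted K_def by simp
  also have "\<dots> \<le> (\<Sum>Y\<in>R. exp ((\<Sum>a\<in>W - Y. ln (2 * t a)) - K))"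
    by (intro sum_mono exp_ge_add_one_self)
  also have "\<dots> = (\<Sum>Y\<in>R. (\<Prod>a\<in>W - Y. 2 * t a) / exp K)"
  proof (rule sum.cong[OF refl])
    fix Y assume Y: "Y \<in> R"
    have "2 * t a > 0" if "a \<in> W - Y" for a
    proof -
      have "card {Y \<in> R. a \<notin> Y} > 0" using Y that finR by (auto simp: card_gt_0_iff)
      then show ?thesis using cR by (simp add: t)
    qed
    then show "exp ((\<Sum>a\<in>W - Y. ln (2 * t a)) - K) = (\<Prod>a\<in>W - Y. 2 * t a) / exp K"
      using assms(1) by (simp add: exp_diff exp_sum)
  qed
  also have "\<dots> = (\<Sum>Y\<in>R. (\<Prod>a\<in>W - Y. 2 * t a)) / exp K" by (simp add: sum_divide_distrib)
  also have "\<dots> \<le> (\<Sum>Y\<in>slice W m. (\<Prod>a\<in>W - Y. 2 * t a)) / exp K"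
    using R assms(1) by (intro divide_right_mono sum_mono2 prod_nonneg) (auto simp: t)
  also have "\<dots> \<le> real (card (slice W m)) / exp K"
    using mac by (intro divide_right_mono) auto
  finally have le: "exp K \<le> real (card (slice W m)) / real (card R)"
    using cR by (simp add: field_simps)
  have "K = ln (exp K)" by simp
  also have "\<dots> \<le> ln (real (card (slice W m)) / real (card R))"
    using le by (subst ln_le_cancel_iff) (auto intro: less_le_trans[OF exp_gt_zero])
  finally show "(\<Sum>a\<in>W. t a * ln (2 * t a)) \<le> ln (real (card (slice W m)) / real (card R))"
    unfolding K_def .
qed

text \<open>Divided by \<open>card M\<close>, the left side is the entropy of
  \<open>\<kappa> Y\<close> for uniform \<open>Y\<close>, hence at most the logarithm of the number
  of values. The proof applies ln x \<le> x - 1 to the ratio between the uniform weight 1/K and the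
  weight of the fibre.\<close>

lemma sum_ln_fibre_le:
  assumes "finite M" "card (\<kappa> ` M) \<le> K"
  shows "(\<Sum>Y\<in>M. ln (real (card M) / real (card {Y' \<in> M. \<kappa> Y' = \<kappa> Y}))) \<le> real (card M) * ln (real K)"
proof (cases "M = {}")
  case False
  then have cM: "card M > 0" and K: "K > 0"
    using assms by (auto simp: card_gt_0_iff intro: Suc_leI less_le_trans)
  let ?F = "\<lambda>v. {Y \<in> M. \<kappa> Y = v}"
  have pos: "card (?F (\<kappa> Y)) > 0" if "Y \<in> M" for Y using that assms(1) by (auto simp: card_gt_0_iff)
  have "(\<Sum>Y\<in>M. ln (real (card M) / real (card (?F (\<kappa> Y)))))
      \<le> (\<Sum>Y\<in>M. ln (real K) + (real (card M) / (real (card (?F (\<kappa> Y))) * real K) - 1))"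
  proof (rule sum_mono)
    fix Y assume "Y \<in> M"
    note p = pos[OF this]
    have "ln (real (card M) / real (card (?F (\<kappa> Y))))
        = ln (real K) + ln (real (card M) / (real (card (?F (\<kappa> Y))) * real K))"
      using p cM K by (simp add: ln_div ln_mult)
    also have "ln (real (card M) / (real (card (?F (\<kappa> Y))) * real K))
        \<le> real (card M) / (real (card (?F (\<kappa> Y))) * real K) - 1"
      using p cM K by (intro ln_le_minus_one) simp
    finally show "ln (real (card M) / real (card (?F (\<kappa> Y))))
      \<le> ln (real K) + (real (card M) / (real (card (?F (\<kappa> Y))) * real K) - 1)" by simp
  qed
  also have "\<dots> = real (card M) * ln (real K) - real (card M)
      + (\<Sum>Y\<in>M. 1 / real (card (?F (\<kappa> Y)))) * (real (card M) / real K)"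
    by (simp add: sum.distrib sum_subtractf sum_divide_distrib sum_distrib_right)
  \<comment> \<open>Each fibre contributes 1 in total, so this sum counts the values of
    \<open>\<kappa>\<close>.\<close>
  also have "(\<Sum>Y\<in>M. 1 / real (card (?F (\<kappa> Y)))) = (\<Sum>v\<in>\<kappa> ` M. \<Sum>Y\<in>?F v. 1 / real (card (?F (\<kappa> Y))))"
    using assms(1) by (rule sum.image_gen)
  also have "\<dots> = (\<Sum>v\<in>\<kappa> ` M. 1)"
    by (rule sum.cong) (use pos in auto)
  also have "\<dots> = real (card (\<kappa> ` M))" by simp
  also have "real (card (\<kappa> ` M)) * (real (card M) / real K) \<le> real K * (real (card M) / real K)"
    using assms(2) by (intro mult_right_mono) auto
  finally show ?thesis using K by simp
qed simp

text \<open>The tower rule: as \<open>h\<close> sees only \<open>\<kappa> Y\<close>, the event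
  \<open>P\<close> may be replaced by its conditional probability given
  \<open>\<kappa> Y\<close>.\<close>

lemma sum_fibre_fraction:
  fixes h :: "'b \<Rightarrow> real"
  assumes "finite M"
  shows "(\<Sum>Y\<in>{Y \<in> M. P Y}. h (\<kappa> Y))
    = (\<Sum>Y\<in>M. real (card {Y' \<in> M. \<kappa> Y' = \<kappa> Y \<and> P Y'}) / real (card {Y' \<in> M. \<kappa> Y' = \<kappa> Y}) * h (\<kappa> Y))"
proof -
  have "(\<Sum>Y\<in>{Y \<in> M. P Y}. h (\<kappa> Y)) = (\<Sum>Y\<in>M. if P Y then h (\<kappa> Y) else 0)"
    using assms by (rule sum.inter_filter)
  also have "\<dots> = (\<Sum>v\<in>\<kappa> ` M. \<Sum>Y\<in>{Y \<in> M. \<kappa> Y = v}. if P Y then h (\<kappa> Y) else 0)"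
    using assms by (rule sum.image_gen)
  also have "\<dots> = (\<Sum>v\<in>\<kappa> ` M. \<Sum>Y\<in>{Y \<in> M. \<kappa> Y = v}.
      real (card {Y' \<in> M. \<kappa> Y' = \<kappa> Y \<and> P Y'}) / real (card {Y' \<in> M. \<kappa> Y' = \<kappa> Y}) * h (\<kappa> Y))"
  proof (rule sum.cong[OF refl])
    fix v assume "v \<in> \<kappa> ` M"
    then have pos: "card {Y \<in> M. \<kappa> Y = v} > 0" using assms by (auto simp: card_gt_0_iff)
    have "(\<Sum>Y\<in>{Y \<in> M. \<kappa> Y = v}. if P Y then h (\<kappa> Y) else 0)
        = (\<Sum>Y\<in>{Y \<in> {Y \<in> M. \<kappa> Y = v}. P Y}. h (\<kappa> Y))"
      using assms by (intro sum.inter_filter[symmetric]) simp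
    also have "\<dots> = (\<Sum>Y\<in>{Y \<in> M. \<kappa> Y = v \<and> P Y}. h v)"
      by (rule sum.cong) auto
    also have "\<dots> = (\<Sum>Y\<in>{Y \<in> M. \<kappa> Y = v}.
        real (card {Y' \<in> M. \<kappa> Y' = v \<and> P Y'}) / real (card {Y' \<in> M. \<kappa> Y' = v}) * h v)"
      using pos by simp
    finally show "(\<Sum>Y\<in>{Y \<in> M. \<kappa> Y = v}. if P Y then h (\<kappa> Y) else 0)
        = (\<Sum>Y\<in>{Y \<in> M. \<kappa> Y = v}. real (card {Y' \<in> M. \<kappa> Y' = \<kappa> Y \<and> P Y'})
            / real (card {Y' \<in> M. \<kappa> Y' = \<kappa> Y}) * h (\<kappa> Y))" by simp
  qed
  also have "\<dots> = (\<Sum>Y\<in>M. real (card {Y' \<in> M. \<kappa> Y' = \<kappa> Y \<and> P Y'}) / real (card {Y' \<in> M. \<kappa> Y' = \<kappa> Y}) * h (\<kappa> Y))"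
    using assms by (rule sum.image_gen[symmetric])
  finally show ?thesis .
qed

text \<open>Turns an entropy bound into a quadratic one. With y = sqrt x, the inequality ln y \<ge>
  1 - 1/y gives x ln x - x + 1 \<ge> (y - 1)^2, while (x - 1)^2 = (y - 1)^2 (y + 1)^2 and (y + 1)^2
  \<le> 6.\<close>

lemma square_le_x_ln_x:
  fixes x :: real
  assumes "0 \<le> x" "x \<le> 2"
  shows "(x - 1)\<^sup>2 / 6 \<le> x * ln x - x + 1"
proof (cases "x = 0")
  case False
  define y where "y = sqrt x"
  have y: "y > 0" "x = y\<^sup>2" "y\<^sup>2 \<le> 2" using assms False by (auto simp: y_def)
  \<comment> \<open>36/25 is a rational upper bound for sqrt 2 that is sharp enough for (61/25)^2
    \<le> 6.\<close>
  have y2: "y \<le> 36/25"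
    by (rule power2_le_imp_le) (use y in \<open>auto simp: power2_eq_square\<close>)
  have "ln (1 / y) \<le> 1 / y - 1" using y by (intro ln_le_minus_one) simp
  then have "1 - 1 / y \<le> ln y" using y by (simp add: ln_div)
  then have "y\<^sup>2 * (2 * (1 - 1 / y)) \<le> y\<^sup>2 * (2 * ln y)" by (intro mult_left_mono) auto
  moreover have "y\<^sup>2 * (2 * (1 - 1 / y)) = 2 * y\<^sup>2 - 2 * y" using y by (simp add: field_simps power2_eq_square)
  moreover have "2 * ln y = ln x" using y(1,2) by (simp add: ln_realpow)
  ultimately have "2 * y\<^sup>2 - 2 * y \<le> x * ln x" using y(2) by simp
  then have "(y - 1)\<^sup>2 \<le> x * ln x - x + 1" using y(2) by (simp add: power2_eq_square algebra_simps)
  moreover have "(x - 1)\<^sup>2 / 6 \<le> (y - 1)\<^sup>2"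
  proof -
    have "(y + 1)\<^sup>2 \<le> (61/25)\<^sup>2" using y y2 by (intro power_mono) auto
    then have "(y + 1)\<^sup>2 / 6 \<le> 1" by (simp add: power2_eq_square)
    then have "(y + 1)\<^sup>2 / 6 * (y - 1)\<^sup>2 \<le> 1 * (y - 1)\<^sup>2" by (intro mult_right_mono) auto
    then show ?thesis using y(2) by (simp add: power2_eq_square algebra_simps)
  qed
  ultimately show ?thesis by linarith
qed simp

text \<open>By the tower rule both sums acquire the weights t, so \<open>slice_entropy\<close>
  applies to each fibre of \<open>\<kappa>\<close>. Averaging its bound over \<open>Y\<close> leaves
  the entropy of the partition, which is at most ln K. In the application \<open>\<kappa>\<close> is
  the transcript as a function of one player's set.\<close>

lemma slice_partition_entropy:
  fixes W :: "'a set" and \<kappa> :: "'a set \<Rightarrow> 'b"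
  defines "t \<equiv> \<lambda>m a v. real (card {Y \<in> slice W m. \<kappa> Y = v \<and> a \<notin> Y}) / real (card {Y \<in> slice W m. \<kappa> Y = v})"
  assumes "finite W" and card_W: "card W = 2 * m" and K: "card (\<kappa> ` slice W m) \<le> K"
  shows "(\<Sum>a\<in>W. \<Sum>Y\<in>{Y \<in> slice W m. a \<notin> Y}. ln (2 * t m a (\<kappa> Y))) \<le> real (card (slice W m)) * ln (real K)"
    and "(\<Sum>a\<in>W. \<Sum>Y\<in>{Y \<in> slice W m. a \<notin> Y}. (t m a (\<kappa> Y) - 1/2)\<^sup>2) \<le> 3 * (real (card (slice W m)) * ln (real K))"
proof -
  let ?M = "slice W m"
  have fin: "finite ?M" using assms by simp
  have regroup: "(\<Sum>a\<in>W. \<Sum>Y\<in>{Y \<in> ?M. a \<notin> Y}. g (t m a (\<kappa> Y)))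
      = (\<Sum>Y\<in>?M. \<Sum>a\<in>W. t m a (\<kappa> Y) * g (t m a (\<kappa> Y)))" for g :: "real \<Rightarrow> real"
  proof -
    have "(\<Sum>a\<in>W. \<Sum>Y\<in>{Y \<in> ?M. a \<notin> Y}. g (t m a (\<kappa> Y)))
        = (\<Sum>a\<in>W. \<Sum>Y\<in>?M. t m a (\<kappa> Y) * g (t m a (\<kappa> Y)))"
      unfolding t_def by (rule sum.cong[OF refl], rule sum_fibre_fraction[OF fin])
    also have "\<dots> = (\<Sum>Y\<in>?M. \<Sum>a\<in>W. t m a (\<kappa> Y) * g (t m a (\<kappa> Y)))" by (rule sum.swap)
    finally show ?thesis .
  qed
  have ent: "(\<Sum>a\<in>W. t m a (\<kappa> Y) * ln (2 * t m a (\<kappa> Y)))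
      \<le> ln (real (card ?M) / real (card {Y' \<in> ?M. \<kappa> Y' = \<kappa> Y}))"
    and tot: "(\<Sum>a\<in>W. t m a (\<kappa> Y)) = real m" if "Y \<in> ?M" for Y
  proof -
    have R: "{Y' \<in> ?M. \<kappa> Y' = \<kappa> Y} \<subseteq> ?M" "{Y' \<in> ?M. \<kappa> Y' = \<kappa> Y} \<noteq> {}" using that by auto
    have t: "t m a (\<kappa> Y) = real (card {Y' \<in> {Y' \<in> ?M. \<kappa> Y' = \<kappa> Y}. a \<notin> Y'})
        / real (card {Y' \<in> ?M. \<kappa> Y' = \<kappa> Y})" for a
      unfolding t_def by (simp add: conj_assoc)
    show "(\<Sum>a\<in>W. t m a (\<kappa> Y) * ln (2 * t m a (\<kappa> Y)))
      \<le> ln (real (card ?M) / real (card {Y' \<in> ?M. \<kappa> Y' = \<kappa> Y}))"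
      "(\<Sum>a\<in>W. t m a (\<kappa> Y)) = real m"
      using slice_entropy[OF assms(2) card_W R t] by auto
  qed
  have main: "(\<Sum>Y\<in>?M. \<Sum>a\<in>W. t m a (\<kappa> Y) * ln (2 * t m a (\<kappa> Y))) \<le> real (card ?M) * ln (real K)"
    by (rule order_trans[OF sum_mono sum_ln_fibre_le[OF fin K]]) (rule ent)
  then show "(\<Sum>a\<in>W. \<Sum>Y\<in>{Y \<in> ?M. a \<notin> Y}. ln (2 * t m a (\<kappa> Y))) \<le> real (card ?M) * ln (real K)"
    by (simp only: regroup[of "\<lambda>x. ln (2 * x)"])
  have "(\<Sum>Y\<in>?M. \<Sum>a\<in>W. t m a (\<kappa> Y) * (t m a (\<kappa> Y) - 1/2)\<^sup>2)
      \<le> (\<Sum>Y\<in>?M. 3 * (\<Sum>a\<in>W. t m a (\<kappa> Y) * ln (2 * t m a (\<kappa> Y))))"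
  proof (rule sum_mono)
    fix Y assume Y: "Y \<in> ?M"
    have "(\<Sum>a\<in>W. t m a (\<kappa> Y) * (t m a (\<kappa> Y) - 1/2)\<^sup>2)
        \<le> (\<Sum>a\<in>W. 3 * (t m a (\<kappa> Y) * ln (2 * t m a (\<kappa> Y)) - t m a (\<kappa> Y) + 1/2))"
    proof (rule sum_mono)
      fix a
      define u where "u = t m a (\<kappa> Y)"
      have "card {Y' \<in> ?M. \<kappa> Y' = \<kappa> Y \<and> a \<notin> Y'} \<le> card {Y' \<in> ?M. \<kappa> Y' = \<kappa> Y}"
        using fin by (intro card_mono) auto
      then have u: "0 \<le> u" "u \<le> 1" unfolding u_def t_def by (auto simp: divide_le_eq_1)
      have "u * (u - 1/2)\<^sup>2 \<le> 1 * (u - 1/2)\<^sup>2" using u by (intro mult_right_mono) auto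
      also have "\<dots> = 3/2 * ((2 * u - 1)\<^sup>2 / 6)" by (simp add: power2_eq_square algebra_simps)
      also have "\<dots> \<le> 3/2 * (2 * u * ln (2 * u) - 2 * u + 1)"
        using square_le_x_ln_x[of "2 * u"] u by (intro mult_left_mono) auto
      also have "\<dots> = 3 * (u * ln (2 * u) - u + 1/2)" by (simp add: algebra_simps)
      finally show "t m a (\<kappa> Y) * (t m a (\<kappa> Y) - 1/2)\<^sup>2
          \<le> 3 * (t m a (\<kappa> Y) * ln (2 * t m a (\<kappa> Y)) - t m a (\<kappa> Y) + 1/2)" unfolding u_def .
    qed
    \<comment> \<open>The linear terms cancel: the t_a sum to m, and 1/2 is added 2m times.\<close>
    also have "\<dots> = 3 * (\<Sum>a\<in>W. t m a (\<kappa> Y) * ln (2 * t m a (\<kappa> Y)))"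
      using tot[OF Y] card_W by (simp add: sum.distrib sum_subtractf flip: sum_distrib_left)
    finally show "(\<Sum>a\<in>W. t m a (\<kappa> Y) * (t m a (\<kappa> Y) - 1/2)\<^sup>2)
      \<le> 3 * (\<Sum>a\<in>W. t m a (\<kappa> Y) * ln (2 * t m a (\<kappa> Y)))" .
  qed
  then have "(\<Sum>Y\<in>?M. \<Sum>a\<in>W. t m a (\<kappa> Y) * (t m a (\<kappa> Y) - 1/2)\<^sup>2) \<le> 3 * (real (card ?M) * ln (real K))"
    using main by (simp flip: sum_distrib_left)
  then show "(\<Sum>a\<in>W. \<Sum>Y\<in>{Y \<in> ?M. a \<notin> Y}. (t m a (\<kappa> Y) - 1/2)\<^sup>2) \<le> 3 * (real (card ?M) * ln (real K))"
    by (simp only: regroup[of "\<lambda>x. (x - 1/2)\<^sup>2"])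
qed


section \<open>Transcripts\<close>

fun transcript :: "protocol \<Rightarrow> (nat \<Rightarrow> nat set) \<Rightarrow> bool list" where
  "transcript (Leaf b) X = []"
| "transcript (Node i f t1 t0) X = (if f (X i) then True # transcript t1 X else False # transcript t0 X)"

fun outcome :: "protocol \<Rightarrow> bool list \<Rightarrow> bool" where
  "outcome (Leaf b) \<tau> = b"
| "outcome (Node i f t1 t0) \<tau> = outcome (if hd \<tau> then t1 else t0) (tl \<tau>)"

text \<open>Player \<open>i\<close>'s side of the rectangle of a transcript: only the bits of player
  \<open>i\<close> are compared with its set, but every player checks that \<open>\<tau>\<close> is
  a complete path to a leaf.\<close>

fun consistent :: "nat \<Rightarrow> protocol \<Rightarrow> bool list \<Rightarrow> nat set \<Rightarrow> bool" where
  "consistent i (Leaf b) \<tau> Y \<longleftrightarrow> \<tau> = []"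
| "consistent i (Node p f t1 t0) [] Y \<longleftrightarrow> False"
| "consistent i (Node p f t1 t0) (b # \<tau>) Y \<longleftrightarrow>
     (p = i \<longrightarrow> f Y = b) \<and> consistent i (if b then t1 else t0) \<tau> Y"

lemma run_eq_outcome: "run t X = outcome t (transcript t X)"
  by (induction t) auto

text \<open>The rectangle property, from which all factorizations over the players follow.
  Boundedness ensures that every speaker is one of the \<open>k\<close> players;
  \<open>0 < k\<close> ensures that somebody checks the length of \<open>\<tau>\<close>.\<close>

lemma transcript_eq_iff:
  assumes "bounded k c t" "0 < k"
  shows "transcript t X = \<tau> \<longleftrightarrow> (\<forall>i<k. consistent i t \<tau> (X i))"
  using assms
proof (induction t arbitrary: c \<tau>)
  case (Leaf b)
  then show ?case by auto
next
  case (Node p f t1 t0)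
  show ?case
  proof (cases \<tau>)
    case Nil
    then show ?thesis using Node.prems by auto
  next
    case (Cons b \<tau>')
    have b: "bounded k (c(p := c p - 1)) t1" "bounded k (c(p := c p - 1)) t0"
      using Node.prems by auto
    have "transcript (if b then t1 else t0) X = \<tau>' \<longleftrightarrow> (\<forall>i<k. consistent i (if b then t1 else t0) \<tau>' (X i))"
    proof (cases b)
      case True
      then show ?thesis using Node.IH(1)[OF b(1) \<open>0 < k\<close>, of \<tau>'] by simp
    next
      case False
      then show ?thesis using Node.IH(2)[OF b(2) \<open>0 < k\<close>, of \<tau>'] by simp
    qed
    moreover have "transcript (Node p f t1 t0) X = \<tau> \<longleftrightarrow> f (X p) = b \<and> transcript (if b then t1 else t0) X = \<tau>'"
      using Cons by auto
    moreover have "p < k" using Node.prems by simp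
    ultimately show ?thesis using Cons by auto
  qed
qed

lemma finite_transcripts: "finite (range (transcript t))"
proof (induction t)
  case (Leaf b)
  then show ?case by simp
next
  case (Node p f t1 t0)
  have "range (transcript (Node p f t1 t0)) \<subseteq> Cons True ` range (transcript t1) \<union> Cons False ` range (transcript t0)"
    by auto
  then show ?case using Node by (meson finite_UnI finite_imageI finite_subset)
qed

text \<open>Once the other inputs are fixed, the tree branches only at the nodes of player
  \<open>i\<close>, and every path has at most \<open>c i\<close> of them.\<close>

lemma card_transcripts_player:
  assumes "bounded k c t"
  shows "card (range (\<lambda>Y. transcript t (X(i := Y)))) \<le> 2 ^ c i"
  using assms
proof (induction t arbitrary: c)
  case (Leaf b)
  then show ?case by simp
next
  case (Node p f t1 t0)
  let ?r = "\<lambda>t. range (\<lambda>Y. transcript t (X(i := Y)))"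
  have fin: "finite (?r t)" for t by (rule finite_subset[OF _ finite_transcripts[of t]]) auto
  have IH: "card (?r t1) \<le> 2 ^ (c(p := c p - 1)) i" "card (?r t0) \<le> 2 ^ (c(p := c p - 1)) i"
    using Node.prems by (auto intro!: Node.IH simp del: fun_upd_apply)
  show ?case
  proof (cases "p = i")
    case True
    have "?r (Node p f t1 t0) \<subseteq> Cons True ` ?r t1 \<union> Cons False ` ?r t0" by auto
    then have "card (?r (Node p f t1 t0)) \<le> card (Cons True ` ?r t1 \<union> Cons False ` ?r t0)"
      using fin by (intro card_mono) auto
    also have "\<dots> \<le> card (Cons True ` ?r t1) + card (Cons False ` ?r t0)" by (rule card_Un_le)
    also have "\<dots> \<le> card (?r t1) + card (?r t0)" using fin by (intro add_mono card_image_le)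
    also have "\<dots> \<le> 2 * 2 ^ (c i - 1)" using IH True by simp
    \<comment> \<open>At a node of player \<open>i\<close>, \<open>bounded\<close> gives 1 \<le>
      \<open>c i\<close>, so the subtraction does not truncate.\<close>
    also have "\<dots> = 2 ^ c i" using Node.prems True by (simp flip: power_Suc)
    finally show ?thesis .
  next
    case False
    define t where "t = (if f (X p) then t1 else t0)"
    have "?r (Node p f t1 t0) = Cons (f (X p)) ` ?r t" using False by (auto simp: t_def)
    then have "card (?r (Node p f t1 t0)) \<le> card (?r t)" using fin by (simp add: card_image_le)
    also have "\<dots> \<le> 2 ^ c i" using IH False by (auto simp: t_def)
    finally show ?thesis .
  qed
qed

section \<open>Hard inputs\<close>

locale hard_inputs =
  fixes k n :: nat and s :: "nat \<Rightarrow> nat"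
  assumes k_pos: "0 < k" and s_pos: "\<And>i. i < k \<Longrightarrow> 1 \<le> s i" and room: "2 * (\<Sum>i<k. s i) \<le> n"
begin

text \<open>With 2 s_i - 1 elements in S_i the window S_i + j has 2 s_i, so a random s_i-subset of
  it contains j with probability exactly 1/2. The extensional product counts every tuple of sets
  once.\<close>

definition configs :: "((nat \<Rightarrow> nat set) \<times> nat) set" where
  "configs = {(S, j). S \<in> (\<Pi>\<^sub>E i\<in>{..<k}. slice {0..<n} (2 * s i - 1)) \<and> disjoint_family_on S {..<k}
     \<and> j < n \<and> (\<forall>i<k. j \<notin> S i)}"

definition window :: "(nat \<Rightarrow> nat set) \<times> nat \<Rightarrow> nat \<Rightarrow> nat set" where
  "window \<omega> i = insert (snd \<omega>) (fst \<omega> i)"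

definition all_sets :: "(nat \<Rightarrow> nat set) \<times> nat \<Rightarrow> nat \<Rightarrow> nat set set" where
  "all_sets \<omega> i = slice (window \<omega> i) (s i)"

definition avoiding :: "(nat \<Rightarrow> nat set) \<times> nat \<Rightarrow> nat \<Rightarrow> nat set set" where
  "avoiding \<omega> i = {Y \<in> all_sets \<omega> i. snd \<omega> \<notin> Y}"

definition containing :: "(nat \<Rightarrow> nat set) \<times> nat \<Rightarrow> nat \<Rightarrow> nat set set" where
  "containing \<omega> i = {Y \<in> all_sets \<omega> i. snd \<omega> \<in> Y}"

text \<open>The number of inputs of either answer in any one configuration, so that counts can stand
  for probabilities.\<close>

definition num_inputs :: nat where
  "num_inputs = (\<Prod>i<k. (2 * s i - 1) choose s i)"

text \<open>For \<open>a\<close> in the window, the old special element joins the i-th set and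
  \<open>a\<close> takes over its role; the i-th window and the other sets stay fixed.\<close>

definition exchange :: "nat \<Rightarrow> nat \<Rightarrow> (nat \<Rightarrow> nat set) \<times> nat \<Rightarrow> (nat \<Rightarrow> nat set) \<times> nat" where
  "exchange i a \<omega> = ((fst \<omega>)(i := window \<omega> i - {a}), a)"

lemma finite_configs: "finite configs"
proof (rule finite_subset)
  show "configs \<subseteq> (\<Pi>\<^sub>E i\<in>{..<k}. slice {0..<n} (2 * s i - 1)) \<times> {..<n}"
    unfolding configs_def by auto
  show "finite ((\<Pi>\<^sub>E i\<in>{..<k}. slice {0..<n} (2 * s i - 1)) \<times> {..<n})"
    by (intro finite_cartesian_product finite_PiE) auto
qed

lemma configs_nonempty: "configs \<noteq> {}"
proof -
  define m where "m i = (\<Sum>l<i. 2 * s l - 1)" for i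
  define S where "S = (\<lambda>i\<in>{..<k}. {m i..<m (Suc i)})"
  have m_mono: "m i \<le> m l" if "i \<le> l" for i l
    unfolding m_def using that by (intro sum_mono2) auto
  have m_Suc: "m (Suc i) = m i + (2 * s i - 1)" for i unfolding m_def by simp
  \<comment> \<open>The sets are consecutive intervals. Each is one shorter than 2 s_i, which leaves
    room for the special element right after them.\<close>
  have "m k < (\<Sum>i<k. 2 * s i)"
    unfolding m_def by (rule sum_strict_mono) (use k_pos s_pos in \<open>auto simp: Suc_le_eq\<close>)
  then have m_k: "m k < n" using room by (simp add: sum_distrib_left)
  have S_sub: "S i \<subseteq> {0..<m k}" if "i < k" for i
    using that m_mono[of "Suc i" k] by (auto simp: S_def)
  have "S \<in> (\<Pi>\<^sub>E i\<in>{..<k}. slice {0..<n} (2 * s i - 1))"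
    using S_sub m_k by (fastforce simp: slice_def S_def m_Suc)
  moreover have "S i \<inter> S l = {}" if "i < l" "l < k" for i l
    using that m_mono[of "Suc i" l] by (auto simp: S_def)
  then have "disjoint_family_on S {..<k}"
    unfolding disjoint_family_on_def by (metis Int_commute lessThan_iff linorder_neqE_nat)
  moreover have "\<forall>i<k. m k \<notin> S i" using S_sub by fastforce
  ultimately have "(S, m k) \<in> configs" using m_k unfolding configs_def by auto
  then show ?thesis by blast
qed

context
  fixes \<omega> i
  assumes \<omega>: "\<omega> \<in> configs" and i: "i < k"
begin

lemma fst_config: "fst \<omega> i \<subseteq> {0..<n}" "card (fst \<omega> i) = 2 * s i - 1" "finite (fst \<omega> i)" "snd \<omega> \<notin> fst \<omega> i"
proof -
  have S: "fst \<omega> i \<in> slice {0..<n} (2 * s i - 1)" "\<forall>i<k. snd \<omega> \<notin> fst \<omega> i"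
    using \<omega> i unfolding configs_def by auto
  then show "fst \<omega> i \<subseteq> {0..<n}" "card (fst \<omega> i) = 2 * s i - 1" unfolding slice_def by auto
  then show "finite (fst \<omega> i)" using finite_subset by blast
  show "snd \<omega> \<notin> fst \<omega> i" using S(2) i by blast
qed

lemma window: "window \<omega> i \<subseteq> {0..<n}" "card (window \<omega> i) = 2 * s i" "finite (window \<omega> i)"
  using fst_config \<omega> s_pos[OF i] unfolding window_def configs_def by auto

lemma avoiding_eq: "avoiding \<omega> i = slice (fst \<omega> i) (s i)"
  using fst_config unfolding avoiding_def all_sets_def window_def slice_def by auto

lemma finite_families: "finite (all_sets \<omega> i)" "finite (avoiding \<omega> i)" "finite (containing \<omega> i)"
  using window unfolding avoiding_def all_sets_def containing_def by auto

lemma card_avoiding: "card (avoiding \<omega> i) = (2 * s i - 1) choose s i"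
  unfolding avoiding_eq using fst_config by (simp add: card_slice)

text \<open>Equivalently, exactly half of the s_i-subsets of a window avoid a given element, by the
  symmetry of the binomial coefficients.\<close>

lemma card_all_sets: "card (all_sets \<omega> i) = 2 * ((2 * s i - 1) choose s i)"
proof -
  obtain m where m: "s i = Suc m" using s_pos[OF i] by (metis Suc_le_D One_nat_def)
  have "(2 * m + 1) choose m = (2 * m + 1) choose (Suc m)"
    using binomial_symmetric[of m "2 * m + 1"] by simp
  then have "(2 * s i) choose s i = 2 * ((2 * s i - 1) choose s i)" using m by simp
  then show ?thesis unfolding all_sets_def using window by (simp add: card_slice)
qed

lemma card_containing: "card (containing \<omega> i) = (2 * s i - 1) choose s i"
proof -
  have "card (all_sets \<omega> i) = card (avoiding \<omega> i) + card (containing \<omega> i)"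
    using finite_families by (subst card_Un_disjoint[symmetric])
      (auto simp: avoiding_def containing_def intro!: arg_cong[where f = card])
  then show ?thesis using card_avoiding card_all_sets by simp
qed

lemma exchange_config:
  assumes a: "a \<in> window \<omega> i"
  shows "exchange i a \<omega> \<in> configs" "window (exchange i a \<omega>) i = window \<omega> i"
    "exchange i (snd \<omega>) (exchange i a \<omega>) = \<omega>" "snd (exchange i a \<omega>) = a"
    "\<And>l. l \<noteq> i \<Longrightarrow> fst (exchange i a \<omega>) l = fst \<omega> l"
proof -
  obtain S j where Sj: "\<omega> = (S, j)" by (cases \<omega>)
  have S: "S \<in> (\<Pi>\<^sub>E i\<in>{..<k}. slice {0..<n} (2 * s i - 1))" "disjoint_family_on S {..<k}" "j < n"
    "\<And>i. i < k \<Longrightarrow> j \<notin> S i"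
    using \<omega> unfolding configs_def Sj by auto
  have a_n: "a < n" using a window by auto
  \<comment> \<open>The whole window misses the other sets, so any of its elements may become the
    special one.\<close>
  have other: "x \<notin> S l" if "l < k" "l \<noteq> i" "x \<in> window \<omega> i" for x l
    using S(2) S(4)[OF that(1)] that i unfolding window_def Sj disjoint_family_on_def by auto
  have "S(i := window \<omega> i - {a}) \<in> (\<Pi>\<^sub>E i\<in>{..<k}. slice {0..<n} (2 * s i - 1))"
  proof -
    have "window \<omega> i - {a} \<in> slice {0..<n} (2 * s i - 1)"
      using window a unfolding slice_def by auto
    then show ?thesis using S(1) i by (auto simp: PiE_iff extensional_def)
  qed
  moreover have "disjoint_family_on (S(i := window \<omega> i - {a})) {..<k}"
  proof (unfold disjoint_family_on_def, intro ballI impI)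
    fix l m assume lm: "l \<in> {..<k}" "m \<in> {..<k}" "l \<noteq> m"
    consider "l = i" | "m = i" | "l \<noteq> i" "m \<noteq> i" by blast
    then show "(S(i := window \<omega> i - {a})) l \<inter> (S(i := window \<omega> i - {a})) m = {}"
    proof cases
      case 1
      then have "(window \<omega> i - {a}) \<inter> S m = {}" using other[of m] lm by blast
      then show ?thesis using 1 lm by simp
    next
      case 2
      then have "S l \<inter> (window \<omega> i - {a}) = {}" using other[of l] lm by blast
      then show ?thesis using 2 lm by simp
    next
      case 3
      then show ?thesis using S(2) lm unfolding disjoint_family_on_def by simp
    qed
  qed
  moreover have "a \<notin> (S(i := window \<omega> i - {a})) l" if "l < k" for l
    using other[OF that _ a] by (cases "l = i") auto
  ultimately show "exchange i a \<omega> \<in> configs"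
    unfolding configs_def exchange_def Sj using a_n by (simp add: window_def)
  show w: "window (exchange i a \<omega>) i = window \<omega> i"
    using a unfolding exchange_def by (auto simp: window_def[of "(_, _)"])
  show "exchange i (snd \<omega>) (exchange i a \<omega>) = \<omega>"
    unfolding exchange_def[of i "snd \<omega>"] w
    using S(4)[OF i] by (auto simp: exchange_def Sj window_def)
qed (auto simp: exchange_def)

end

text \<open>The exchange is an involution on pairs of a configuration and an element of its \<open>i\<close>-th window; the
  identity says that the special element is uniform in the window, given the window and the
  other sets.\<close>

lemma sum_exchange:
  fixes F :: "_ \<Rightarrow> real"
  assumes i: "i < k"
  shows "(\<Sum>\<omega>\<in>configs. \<Sum>a\<in>window \<omega> i. F (exchange i a \<omega>)) = 2 * real (s i) * (\<Sum>\<omega>\<in>configs. F \<omega>)"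
proof -
  let ?D = "SIGMA \<omega>:configs. window \<omega> i"
  have "(\<Sum>\<omega>\<in>configs. \<Sum>a\<in>window \<omega> i. F (exchange i a \<omega>)) = (\<Sum>(\<omega>, a)\<in>?D. F (exchange i a \<omega>))"
    using finite_configs window[OF _ i] by (intro sum.Sigma) auto
  also have "\<dots> = (\<Sum>(\<omega>, a)\<in>?D. F \<omega>)"
  proof (rule sum.reindex_bij_witness[where i = "\<lambda>(\<omega>, a). (exchange i a \<omega>, snd \<omega>)"
        and j = "\<lambda>(\<omega>, a). (exchange i a \<omega>, snd \<omega>)"])
    fix x assume x: "x \<in> ?D"
    obtain \<omega> a where xa: "x = (\<omega>, a)" "\<omega> \<in> configs" "a \<in> window \<omega> i" using x by auto
    note ex = exchange_config[OF xa(2) i xa(3)]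
    show "(\<lambda>(\<omega>, a). (exchange i a \<omega>, snd \<omega>)) ((\<lambda>(\<omega>, a). (exchange i a \<omega>, snd \<omega>)) x) = x"
      using ex xa by simp
    then show "(\<lambda>(\<omega>, a). (exchange i a \<omega>, snd \<omega>)) ((\<lambda>(\<omega>, a). (exchange i a \<omega>, snd \<omega>)) x) = x" .
    show "(\<lambda>(\<omega>, a). (exchange i a \<omega>, snd \<omega>)) x \<in> ?D"
      using ex xa by (auto simp: window_def)
    then show "(\<lambda>(\<omega>, a). (exchange i a \<omega>, snd \<omega>)) x \<in> ?D" .
    show "(case (case x of (\<omega>, a) \<Rightarrow> (exchange i a \<omega>, snd \<omega>)) of (\<omega>, a) \<Rightarrow> F \<omega>)
        = (case x of (\<omega>, a) \<Rightarrow> F (exchange i a \<omega>))"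
      using xa by simp
  qed
  also have "\<dots> = (\<Sum>\<omega>\<in>configs. \<Sum>a\<in>window \<omega> i. F \<omega>)"
    using finite_configs window[OF _ i] by (intro sum.Sigma[symmetric]) auto
  also have "\<dots> = 2 * real (s i) * (\<Sum>\<omega>\<in>configs. F \<omega>)"
    using window(2)[OF _ i] by (simp add: sum_distrib_left)
  finally show ?thesis .
qed

section \<open>Input counts, and fixing the public coins\<close>

lemma card_PiE_avoiding: "\<omega> \<in> configs \<Longrightarrow> card (Pi\<^sub>E {..<k} (avoiding \<omega>)) = num_inputs"
  and card_PiE_containing: "\<omega> \<in> configs \<Longrightarrow> card (Pi\<^sub>E {..<k} (containing \<omega>)) = num_inputs"
  and card_PiE_all_sets: "\<omega> \<in> configs \<Longrightarrow> card (Pi\<^sub>E {..<k} (all_sets \<omega>)) = 2 ^ k * num_inputs"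
  unfolding num_inputs_def
  by (simp_all add: card_PiE card_avoiding card_containing card_all_sets prod.distrib)

lemma finite_PiE_families:
  assumes "\<omega> \<in> configs"
  shows "finite (Pi\<^sub>E {..<k} (avoiding \<omega>))" "finite (Pi\<^sub>E {..<k} (containing \<omega>))" "finite (Pi\<^sub>E {..<k} (all_sets \<omega>))"
  using finite_families[OF assms] by (auto intro!: finite_PiE)

lemma num_inputs_pos: "0 < num_inputs"
  unfolding num_inputs_def using s_pos by (intro prod_pos) fastforce

lemma avoiding_inputs:
  assumes \<omega>: "\<omega> \<in> configs" and X: "X \<in> Pi\<^sub>E {..<k} (avoiding \<omega>)"
  shows "X \<in> F0 k n" "sized k s X"
proof -
  have Xi: "X i \<subseteq> fst \<omega> i" "card (X i) = s i" if "i < k" for i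
    using X that avoiding_eq[OF \<omega> that] unfolding slice_def by (auto simp: PiE_iff)
  then show "sized k s X" unfolding sized_def by simp
  have disj: "disjoint_family_on (fst \<omega>) {..<k}" using \<omega> unfolding configs_def by auto
  have "colweight k X j \<le> 1" for j
    unfolding colweight_def
  proof (rule card_le_Suc0_iff_eq[THEN iffD2, folded One_nat_def])
    show "\<forall>x\<in>{i. i < k \<and> j \<in> X i}. \<forall>y\<in>{i. i < k \<and> j \<in> X i}. x = y"
      using disj Xi(1) unfolding disjoint_family_on_def by blast
  qed simp
  then show "X \<in> F0 k n"
    using Xi(1) fst_config(1)[OF \<omega>] unfolding F0_def valid_input_def by blast
qed

lemma containing_inputs:
  assumes \<omega>: "\<omega> \<in> configs" and X: "X \<in> Pi\<^sub>E {..<k} (containing \<omega>)"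
  shows "X \<in> F1 k n" "sized k s X"
proof -
  have Xi: "X i \<subseteq> window \<omega> i" "card (X i) = s i" "snd \<omega> \<in> X i" if "i < k" for i
    using X that unfolding containing_def all_sets_def slice_def by (auto simp: PiE_iff)
  then show "sized k s X" unfolding sized_def by simp
  have disj: "disjoint_family_on (fst \<omega>) {..<k}" and j: "snd \<omega> < n" using \<omega> unfolding configs_def by auto
  have "colweight k X j' \<le> 1" if "j' \<noteq> snd \<omega>" for j'
    unfolding colweight_def
  proof (rule card_le_Suc0_iff_eq[THEN iffD2, folded One_nat_def])
    show "\<forall>x\<in>{i. i < k \<and> j' \<in> X i}. \<forall>y\<in>{i. i < k \<and> j' \<in> X i}. x = y"
      using disj Xi(1) that unfolding disjoint_family_on_def window_def by blast
  qed simp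
  moreover have "{i. i < k \<and> snd \<omega> \<in> X i} = {..<k}" using Xi(3) by auto
  then have "colweight k X (snd \<omega>) = k" unfolding colweight_def by simp
  ultimately show "X \<in> F1 k n"
    using Xi(1) window(1)[OF \<omega>] j unfolding F1_def valid_input_def by blast
qed

text \<open>Averaging over the coins: every input of either kind has error at most 1/100, so some
  deterministic protocol in the support does not exceed the expected number of errors, 1/100 for
  each of the two kinds.\<close>

lemma exists_good_protocol:
  assumes solves: "solves_UDISJ k n s P"
  shows "\<exists>t\<in>set_pmf P. (\<Sum>\<omega>\<in>configs. real (card {X \<in> Pi\<^sub>E {..<k} (avoiding \<omega>). run t X})
      + real (card {X \<in> Pi\<^sub>E {..<k} (containing \<omega>). \<not> run t X})) \<le> 2/100 * (real (card configs) * real num_inputs)"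
proof (rule ccontr)
  define err where "err t = (\<Sum>\<omega>\<in>configs. (\<Sum>X\<in>Pi\<^sub>E {..<k} (avoiding \<omega>). indicat_real {t. run t X} t)
      + (\<Sum>X\<in>Pi\<^sub>E {..<k} (containing \<omega>). indicat_real {t. \<not> run t X} t))" for t
  have err: "err t = (\<Sum>\<omega>\<in>configs. real (card {X \<in> Pi\<^sub>E {..<k} (avoiding \<omega>). run t X})
      + real (card {X \<in> Pi\<^sub>E {..<k} (containing \<omega>). \<not> run t X}))" for t
    unfolding err_def using finite_PiE_families
    by (intro sum.cong refl arg_cong2[where f = "(+)"])
      (auto simp: indicator_def simp flip: sum.inter_filter intro!: arg_cong[where f = card])
  let ?b = "2/100 * (real (card configs) * real num_inputs)"
  assume "\<not> ?thesis"
  then have "AE t in measure_pmf P. ?b < err t" unfolding err by (auto simp: AE_measure_pmf_iff not_le)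
  moreover have int: "integrable (measure_pmf P) err"
    unfolding err_def by (intro Bochner_Integration.integrable_sum Bochner_Integration.integrable_add
        integrable_real_indicator) (auto simp: measure_pmf.emeasure_eq_measure)
  ultimately have "?b < measure_pmf.expectation P err"
    by (intro measure_pmf.expectation_greater)
  also have "\<dots> = (\<Sum>\<omega>\<in>configs. (\<Sum>X\<in>Pi\<^sub>E {..<k} (avoiding \<omega>). measure_pmf.prob P {t. run t X})
      + (\<Sum>X\<in>Pi\<^sub>E {..<k} (containing \<omega>). measure_pmf.prob P {t. \<not> run t X}))"
    unfolding err_def by (simp add: measure_pmf.emeasure_eq_measure)
  also have "\<dots> \<le> (\<Sum>\<omega>\<in>configs. (\<Sum>X\<in>Pi\<^sub>E {..<k} (avoiding \<omega>). 1/100) + (\<Sum>X\<in>Pi\<^sub>E {..<k} (containing \<omega>). 1/100))"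
  proof (intro sum_mono add_mono)
    fix \<omega> X assume *: "\<omega> \<in> configs" "X \<in> Pi\<^sub>E {..<k} (avoiding \<omega>)"
    have "99/100 \<le> measure_pmf.prob P {t. run t X = False}"
      using solves avoiding_inputs[OF *] unfolding solves_UDISJ_def by blast
    moreover have "{t. run t X} = UNIV - {t. run t X = False}" by auto
    ultimately show "measure_pmf.prob P {t. run t X} \<le> 1/100"
      using measure_pmf.prob_compl[of "{t. run t X = False}" P] by simp
  next
    fix \<omega> X assume *: "\<omega> \<in> configs" "X \<in> Pi\<^sub>E {..<k} (containing \<omega>)"
    have "99/100 \<le> measure_pmf.prob P {t. run t X = True}"
      using solves containing_inputs[OF *] unfolding solves_UDISJ_def by blast
    moreover have "{t. \<not> run t X} = UNIV - {t. run t X = True}" by auto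
    ultimately show "measure_pmf.prob P {t. \<not> run t X} \<le> 1/100"
      using measure_pmf.prob_compl[of "{t. run t X = True}" P] by simp
  qed
  also have "\<dots> = ?b" by (simp add: card_PiE_avoiding card_PiE_containing)
  finally show False by simp
qed

end


section \<open>Likelihood ratios of transcripts\<close>

lemma sum_PiE_remove:
  fixes h :: "('a \<Rightarrow> 'b) \<Rightarrow> real"
  assumes "i \<in> I"
  shows "(\<Sum>X\<in>Pi\<^sub>E I B. h X) = (\<Sum>X\<in>Pi\<^sub>E (I - {i}) B. \<Sum>Y\<in>B i. h (X(i := Y)))"
proof -
  have "Pi\<^sub>E I B = (\<lambda>(Y, X). X(i := Y)) ` (B i \<times> Pi\<^sub>E (I - {i}) B)"
    using PiE_insert_eq[of i "I - {i}" B] assms by (simp add: insert_absorb)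
  moreover have "inj_on (\<lambda>(Y, X). X(i := Y)) (B i \<times> Pi\<^sub>E (I - {i}) B)"
    by (rule inj_combinator) simp
  ultimately have "(\<Sum>X\<in>Pi\<^sub>E I B. h X) = (\<Sum>(Y, X)\<in>B i \<times> Pi\<^sub>E (I - {i}) B. h (X(i := Y)))"
    by (simp add: sum.reindex case_prod_unfold)
  also have "\<dots> = (\<Sum>Y\<in>B i. \<Sum>X\<in>Pi\<^sub>E (I - {i}) B. h (X(i := Y)))"
    by (rule sum.cartesian_product[symmetric])
  also have "\<dots> = (\<Sum>X\<in>Pi\<^sub>E (I - {i}) B. \<Sum>Y\<in>B i. h (X(i := Y)))" by (rule sum.swap)
  finally show ?thesis .
qed

text \<open>The odds times (2f)^2 equal 4 f (1 - f) = 1 - y with y = 4 (f - 1/2)^2, and ln (1 - y)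
  \<ge> -2y for 0 \<le> y \<le> 1/2. Thus the likelihood ratio is controlled by ln (2f) up to a
  quadratic error.\<close>

lemma ln_odds_ge:
  fixes f :: real
  assumes "\<bar>f - 1/2\<bar> \<le> 1/4"
  shows "- 2 * ln (2 * f) - 8 * (f - 1/2)\<^sup>2 \<le> ln ((1 - f) / f)"
proof -
  have f: "1/4 \<le> f" "f \<le> 3/4" using assms unfolding abs_le_iff by linarith+
  define y where "y = 4 * (f - 1/2)\<^sup>2"
  have "(f - 1/2)\<^sup>2 \<le> (1/4)\<^sup>2" using assms power_mono[OF assms, of 2] by simp
  then have y: "0 \<le> y" "y \<le> 1/2" unfolding y_def by (auto simp: power2_eq_square)
  have "- y - 2 * y\<^sup>2 \<le> ln (1 - y)" using y by (rule ln_one_minus_pos_lower_bound)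
  moreover have "y\<^sup>2 \<le> y / 2" using mult_left_mono[OF y(2) y(1)] by (simp add: power2_eq_square)
  ultimately have "- 2 * y \<le> ln (1 - y)" by simp
  also have "1 - y = (2 * f) * (2 * f) * ((1 - f) / f)"
    using f by (simp add: y_def power2_eq_square field_simps)
  also have "ln \<dots> = 2 * ln (2 * f) + ln ((1 - f) / f)"
  proof -
    have ln: "ln (a * a * b) = 2 * ln a + ln b" if "0 < a" "0 < b" for a b :: real
      using that by (simp add: ln_mult)
    show ?thesis by (rule ln) (use f in auto)
  qed
  finally show ?thesis unfolding y_def by simp
qed

lemma exp_neg_half_ge: "(9/16 :: real) \<le> exp (- (1/2))"
proof -
  have "(3/4 :: real) \<le> exp (- (1/4))" using exp_ge_add_one_self[of "- (1/4) :: real"] by simp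
  then have "(3/4 :: real)\<^sup>2 \<le> (exp (- (1/4)))\<^sup>2" by (intro power_mono) auto
  also have "\<dots> = exp (- (1/2) :: real)" by (simp flip: exp_double)
  finally show ?thesis by (simp add: power2_eq_square)
qed

text \<open>The function z + exp (-z) - 1 is convex and vanishes at its minimum 0. The tangent of
  exp (-z) at 1/2 bounds it below by exp (-1/2) - 1/2 on the given range. It serves for a Markov
  bound on the gain, which may be negative.\<close>

lemma deviation_ge:
  fixes z :: real
  assumes "1/2 \<le> z"
  shows "1/16 \<le> z + exp (- z) - 1"
proof -
  define u where "u = exp (- (1/2) :: real)"
  have u: "9/16 \<le> u" "u \<le> 1" using exp_neg_half_ge by (auto simp: u_def)
  have "u * (1 + (1/2 - z)) \<le> u * exp (1/2 - z)" using u by (intro mult_left_mono exp_ge_add_one_self) auto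
  also have "\<dots> = exp (- z)" unfolding u_def by (simp flip: exp_add)
  finally have "u * (3/2 - z) \<le> exp (- z)" by simp
  moreover have "(1 - u) * (1/2) \<le> (1 - u) * z" using u assms by (intro mult_left_mono) auto
  ultimately show ?thesis using u unfolding left_diff_distrib right_diff_distrib by linarith
qed

locale hard_protocol = hard_inputs +
  fixes t :: protocol and c :: "nat \<Rightarrow> nat"
  assumes bounded: "bounded k c t"
begin

section \<open>Transcript counts and the contribution of one player\<close>

definition hits :: "(nat \<Rightarrow> nat set set) \<Rightarrow> nat \<Rightarrow> bool list \<Rightarrow> nat" where
  "hits B i \<tau> = card {Y \<in> B i. consistent i t \<tau> Y}"

text \<open>The conditional probability f_i. It is 0 by convention if no set is consistent with
  \<open>\<tau>\<close>, which does not happen at transcripts of \<open>avoiding\<close>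
  inputs.\<close>

definition avoid_frac :: "(nat \<Rightarrow> nat set) \<times> nat \<Rightarrow> nat \<Rightarrow> bool list \<Rightarrow> real" where
  "avoid_frac \<omega> i \<tau> = real (hits (avoiding \<omega>) i \<tau>) / real (hits (all_sets \<omega>) i \<tau>)"

text \<open>By the factorization over the players, \<open>gain \<omega> \<tau>\<close> is the logarithm of the ratio between the
  probabilities of \<open>\<tau>\<close> when all sets avoid the special element and when they are independent and
  unconstrained in their windows. The latter inputs violate the promise, but they still give a
  probability distribution on transcripts, which bounds the expectation of \<open>exp (- gain)\<close>.\<close>

definition gain :: "(nat \<Rightarrow> nat set) \<times> nat \<Rightarrow> bool list \<Rightarrow> real" where
  "gain \<omega> \<tau> = (\<Sum>i<k. ln (2 * avoid_frac \<omega> i \<tau>))"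

definition spread :: "(nat \<Rightarrow> nat set) \<times> nat \<Rightarrow> bool list \<Rightarrow> real" where
  "spread \<omega> \<tau> = (\<Sum>i<k. (avoid_frac \<omega> i \<tau> - 1/2)\<^sup>2)"

text \<open>The bound on the spread keeps every \<open>avoid_frac\<close> within 1/4 of 1/2, as
  \<open>ln_odds_ge\<close> demands; together the two thresholds keep the log-likelihood ratio above
  -3/2.\<close>

definition typical :: "(nat \<Rightarrow> nat set) \<times> nat \<Rightarrow> bool list \<Rightarrow> bool" where
  "typical \<omega> \<tau> \<longleftrightarrow> gain \<omega> \<tau> < 1/2 \<and> spread \<omega> \<tau> < 1/16"

lemma transcript_iff: "transcript t X = \<tau> \<longleftrightarrow> (\<forall>i<k. consistent i t \<tau> (X i))"
  by (rule transcript_eq_iff[OF bounded k_pos])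

lemma card_transcript_fibre:
  "card {X \<in> Pi\<^sub>E {..<k} B. transcript t X = \<tau>} = (\<Prod>i<k. hits B i \<tau>)"
proof -
  have "{X \<in> Pi\<^sub>E {..<k} B. transcript t X = \<tau>} = (\<Pi>\<^sub>E i\<in>{..<k}. {Y \<in> B i. consistent i t \<tau> Y})"
    unfolding transcript_iff by (rule set_eqI) (simp add: PiE_iff, blast)
  then show ?thesis unfolding hits_def by (simp add: card_PiE)
qed

lemma sum_over_transcripts:
  fixes h :: "bool list \<Rightarrow> real"
  assumes "finite (Pi\<^sub>E {..<k} B)"
  shows "(\<Sum>X\<in>Pi\<^sub>E {..<k} B. h (transcript t X)) = (\<Sum>\<tau>\<in>range (transcript t). real (\<Prod>i<k. hits B i \<tau>) * h \<tau>)"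
proof -
  have "(\<Sum>X\<in>Pi\<^sub>E {..<k} B. h (transcript t X))
      = (\<Sum>\<tau>\<in>range (transcript t). \<Sum>X\<in>{X \<in> Pi\<^sub>E {..<k} B. transcript t X = \<tau>}. h (transcript t X))"
    by (rule sum.group[symmetric]) (use assms finite_transcripts in auto)
  also have "\<dots> = (\<Sum>\<tau>\<in>range (transcript t). \<Sum>X\<in>{X \<in> Pi\<^sub>E {..<k} B. transcript t X = \<tau>}. h \<tau>)"
    by (intro sum.cong) auto
  finally show ?thesis by (simp add: card_transcript_fibre)
qed

text \<open>The exchange makes the special element uniform in the i-th window while the other
  players' sets are fixed. The transcript is then a function of player \<open>i\<close>'s set with
  at most \<open>2 ^ c i\<close> values, so the hypothesis on slices applies. It is stated for
  general \<open>g\<close> to cover both the gain and the spread.\<close>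

lemma player_average:
  fixes g :: "real \<Rightarrow> real"
  assumes i: "i < k"
    and g: "\<And>W (\<kappa> :: nat set \<Rightarrow> bool list). finite W \<Longrightarrow> card W = 2 * s i \<Longrightarrow> card (\<kappa> ` slice W (s i)) \<le> 2 ^ c i \<Longrightarrow>
      (\<Sum>a\<in>W. \<Sum>Y\<in>{Y \<in> slice W (s i). a \<notin> Y}. g (real (card {Y' \<in> slice W (s i). \<kappa> Y' = \<kappa> Y \<and> a \<notin> Y'})
        / real (card {Y' \<in> slice W (s i). \<kappa> Y' = \<kappa> Y}))) \<le> real (card (slice W (s i))) * b"
  shows "(\<Sum>\<omega>\<in>configs. \<Sum>X\<in>Pi\<^sub>E {..<k} (avoiding \<omega>). g (avoid_frac \<omega> i (transcript t X)))
    \<le> real (card configs) * real num_inputs * (b / real (s i))"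
proof -
  define F where "F \<omega> = (\<Sum>X\<in>Pi\<^sub>E {..<k} (avoiding \<omega>). g (avoid_frac \<omega> i (transcript t X)))" for \<omega>
  define m where "m = (2 * s i - 1) choose s i"
  define rest where "rest = (\<Prod>l\<in>{..<k} - {i}. (2 * s l - 1) choose s l)"
  have vol: "num_inputs = m * rest"
    unfolding num_inputs_def m_def rest_def using i by (simp add: prod.remove[of "{..<k}" i])
  have F: "(\<Sum>a\<in>window \<omega> i. F (exchange i a \<omega>)) \<le> real rest * (2 * real m * b)" if \<omega>: "\<omega> \<in> configs" for \<omega>
  proof -
    let ?W = "window \<omega> i"
    let ?M = "slice ?W (s i)"
    let ?C = "Pi\<^sub>E ({..<k} - {i}) (avoiding \<omega>)"
    have Fa: "F (exchange i a \<omega>) = (\<Sum>X\<in>?C. \<Sum>Y\<in>{Y \<in> ?M. a \<notin> Y}.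
        g (real (card {Y' \<in> ?M. transcript t (X(i := Y')) = transcript t (X(i := Y)) \<and> a \<notin> Y'})
          / real (card {Y' \<in> ?M. transcript t (X(i := Y')) = transcript t (X(i := Y))})))"
      if a: "a \<in> ?W" for a
    proof -
      note ex = exchange_config[OF \<omega> i a]
      have all: "all_sets (exchange i a \<omega>) i = ?M" unfolding all_sets_def ex(2) ..
      have av: "avoiding (exchange i a \<omega>) i = {Y \<in> ?M. a \<notin> Y}" unfolding avoiding_def all ex(4) ..
      \<comment> \<open>The other players' sets are drawn from S_l, which does not depend on the
        special element.\<close>
      have "avoiding (exchange i a \<omega>) l = avoiding \<omega> l" if "l < k" "l \<noteq> i" for l
        using avoiding_eq[OF ex(1) that(1)] avoiding_eq[OF \<omega> that(1)] ex(5)[OF that(2)] by simp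
      then have C: "Pi\<^sub>E ({..<k} - {i}) (avoiding (exchange i a \<omega>)) = ?C"
        by (intro PiE_cong) auto
      have "F (exchange i a \<omega>) = (\<Sum>X\<in>?C. \<Sum>Y\<in>{Y \<in> ?M. a \<notin> Y}. g (avoid_frac (exchange i a \<omega>) i (transcript t (X(i := Y)))))"
        unfolding F_def using i by (subst sum_PiE_remove[where i = i]) (simp_all add: C av)
      also have "\<dots> = (\<Sum>X\<in>?C. \<Sum>Y\<in>{Y \<in> ?M. a \<notin> Y}.
        g (real (card {Y' \<in> ?M. transcript t (X(i := Y')) = transcript t (X(i := Y)) \<and> a \<notin> Y'})
          / real (card {Y' \<in> ?M. transcript t (X(i := Y')) = transcript t (X(i := Y))})))"
      proof (intro sum.cong refl)
        fix X Y
        \<comment> \<open>The other players already agree with this transcript, so only the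
          consistency of player \<open>i\<close> is left to check.\<close>
        have "consistent i t (transcript t (X(i := Y))) Y' \<longleftrightarrow> transcript t (X(i := Y')) = transcript t (X(i := Y))" for Y'
        proof -
          have "\<forall>l<k. consistent l t (transcript t (X(i := Y))) ((X(i := Y)) l)" using transcript_iff[of "X(i := Y)" "transcript t (X(i := Y))"] by blast
          then show ?thesis unfolding transcript_iff[of "X(i := Y')"] using i by auto
        qed
        then show "g (avoid_frac (exchange i a \<omega>) i (transcript t (X(i := Y))))
          = g (real (card {Y' \<in> ?M. transcript t (X(i := Y')) = transcript t (X(i := Y)) \<and> a \<notin> Y'})
          / real (card {Y' \<in> ?M. transcript t (X(i := Y')) = transcript t (X(i := Y))}))"
          unfolding avoid_frac_def hits_def all av by (simp add: conj_ac)
      qed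
      finally show ?thesis .
    qed
    have "(\<Sum>a\<in>?W. F (exchange i a \<omega>)) = (\<Sum>X\<in>?C. \<Sum>a\<in>?W. \<Sum>Y\<in>{Y \<in> ?M. a \<notin> Y}.
        g (real (card {Y' \<in> ?M. transcript t (X(i := Y')) = transcript t (X(i := Y)) \<and> a \<notin> Y'})
          / real (card {Y' \<in> ?M. transcript t (X(i := Y')) = transcript t (X(i := Y))})))"
      by (subst sum.swap) (simp only: Fa cong: sum.cong)
    also have "\<dots> \<le> (\<Sum>X\<in>?C. real (card ?M) * b)"
    proof (rule sum_mono)
      fix X
      have "finite (range (\<lambda>Y. transcript t (X(i := Y))))"
        by (rule finite_subset[OF _ finite_transcripts[of t]]) auto
      then have "card ((\<lambda>Y. transcript t (X(i := Y))) ` ?M) \<le> 2 ^ c i"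
        using card_transcripts_player[OF bounded, of X i] by (meson card_mono image_mono le_trans subset_UNIV)
      then show "(\<Sum>a\<in>?W. \<Sum>Y\<in>{Y \<in> ?M. a \<notin> Y}.
        g (real (card {Y' \<in> ?M. transcript t (X(i := Y')) = transcript t (X(i := Y)) \<and> a \<notin> Y'})
          / real (card {Y' \<in> ?M. transcript t (X(i := Y')) = transcript t (X(i := Y))}))) \<le> real (card ?M) * b"
        using g[of ?W "\<lambda>Y. transcript t (X(i := Y))"] window[OF \<omega> i] by blast
    qed
    also have "\<dots> = real (card ?C) * (2 * real m * b)"
      using card_all_sets[OF \<omega> i] unfolding all_sets_def m_def by simp
    also have "card ?C = rest"
      unfolding rest_def by (simp add: card_PiE card_avoiding[OF \<omega>])
    finally show ?thesis .
  qed
  \<comment> \<open>The division by s_i in the final bound arises here, from the size of the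
    window.\<close>
  have "2 * real (s i) * (\<Sum>\<omega>\<in>configs. F \<omega>) = (\<Sum>\<omega>\<in>configs. \<Sum>a\<in>window \<omega> i. F (exchange i a \<omega>))"
    by (rule sum_exchange[OF i, symmetric])
  also have "\<dots> \<le> (\<Sum>\<omega>\<in>configs. real rest * (2 * real m * b))" by (intro sum_mono F)
  also have "\<dots> = 2 * (real (card configs) * real num_inputs * b)" unfolding vol by simp
  finally show ?thesis using s_pos[OF i] unfolding F_def by (simp add: field_simps)
qed

section \<open>Total expected gain and spread\<close>

definition cost :: real where
  "cost = (\<Sum>i<k. real (c i) / real (s i))"

lemma ln_2_le_1: "ln (2 :: real) \<le> 1"
  using ln_le_minus_one[of "2 :: real"] by simp

lemma sum_gain_le:
  "(\<Sum>\<omega>\<in>configs. \<Sum>X\<in>Pi\<^sub>E {..<k} (avoiding \<omega>). gain \<omega> (transcript t X)) \<le> real (card configs) * real num_inputs * cost"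
proof -
  have "(\<Sum>\<omega>\<in>configs. \<Sum>X\<in>Pi\<^sub>E {..<k} (avoiding \<omega>). gain \<omega> (transcript t X))
      = (\<Sum>i<k. \<Sum>\<omega>\<in>configs. \<Sum>X\<in>Pi\<^sub>E {..<k} (avoiding \<omega>). ln (2 * avoid_frac \<omega> i (transcript t X)))"
    unfolding gain_def by (simp add: sum.swap[of _ "{..<k}"])
  also have "\<dots> \<le> (\<Sum>i<k. real (card configs) * real num_inputs * (real (c i) / real (s i)))"
  proof (intro sum_mono player_average)
    fix i W and \<kappa> :: "nat set \<Rightarrow> bool list"
    assume W: "finite W" "card W = 2 * s i" "card (\<kappa> ` slice W (s i)) \<le> 2 ^ c i"
    have "ln (real (2 ^ c i)) \<le> real (c i)"
      using mult_left_mono[OF ln_2_le_1, of "real (c i)"] by (simp add: ln_realpow)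
    then show "(\<Sum>a\<in>W. \<Sum>Y\<in>{Y \<in> slice W (s i). a \<notin> Y}. ln (2 * (real (card {Y' \<in> slice W (s i). \<kappa> Y' = \<kappa> Y \<and> a \<notin> Y'})
        / real (card {Y' \<in> slice W (s i). \<kappa> Y' = \<kappa> Y})))) \<le> real (card (slice W (s i))) * real (c i)"
      by (intro order_trans[OF slice_partition_entropy(1)[OF W]] mult_left_mono) auto
  qed auto
  also have "\<dots> = real (card configs) * real num_inputs * cost" unfolding cost_def by (simp add: sum_distrib_left)
  finally show ?thesis .
qed

lemma sum_spread_le:
  "(\<Sum>\<omega>\<in>configs. \<Sum>X\<in>Pi\<^sub>E {..<k} (avoiding \<omega>). spread \<omega> (transcript t X)) \<le> 3 * (real (card configs) * real num_inputs * cost)"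
proof -
  have "(\<Sum>\<omega>\<in>configs. \<Sum>X\<in>Pi\<^sub>E {..<k} (avoiding \<omega>). spread \<omega> (transcript t X))
      = (\<Sum>i<k. \<Sum>\<omega>\<in>configs. \<Sum>X\<in>Pi\<^sub>E {..<k} (avoiding \<omega>). (avoid_frac \<omega> i (transcript t X) - 1/2)\<^sup>2)"
    unfolding spread_def by (simp add: sum.swap[of _ "{..<k}"])
  also have "\<dots> \<le> (\<Sum>i<k. real (card configs) * real num_inputs * (3 * real (c i) / real (s i)))"
  proof (intro sum_mono player_average)
    fix i W and \<kappa> :: "nat set \<Rightarrow> bool list"
    assume W: "finite W" "card W = 2 * s i" "card (\<kappa> ` slice W (s i)) \<le> 2 ^ c i"
    have "ln (real (2 ^ c i)) \<le> real (c i)"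
      using mult_left_mono[OF ln_2_le_1, of "real (c i)"] by (simp add: ln_realpow)
    then have "3 * (real (card (slice W (s i))) * ln (real (2 ^ c i))) \<le> 3 * (real (card (slice W (s i))) * real (c i))"
      by (intro mult_left_mono) auto
    with slice_partition_entropy(2)[OF W]
    show "(\<Sum>a\<in>W. \<Sum>Y\<in>{Y \<in> slice W (s i). a \<notin> Y}. (real (card {Y' \<in> slice W (s i). \<kappa> Y' = \<kappa> Y \<and> a \<notin> Y'})
        / real (card {Y' \<in> slice W (s i). \<kappa> Y' = \<kappa> Y}) - 1/2)\<^sup>2) \<le> real (card (slice W (s i))) * (3 * real (c i))"
      by (simp only: mult.left_commute[of _ 3])
  qed auto
  also have "\<dots> = 3 * (real (card configs) * real num_inputs * cost)"
    unfolding cost_def by (simp add: sum_distrib_left algebra_simps)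
  finally show ?thesis .
qed

section \<open>Comparing the two answers within one configuration\<close>

context
  fixes \<omega>
  assumes \<omega>: "\<omega> \<in> configs"
begin

lemma hits_split:
  assumes "i < k"
  shows "hits (all_sets \<omega>) i \<tau> = hits (avoiding \<omega>) i \<tau> + hits (containing \<omega>) i \<tau>"
  unfolding hits_def using finite_families[OF \<omega> assms]
  by (subst card_Un_disjoint[symmetric])
    (auto simp: avoiding_def containing_def intro!: arg_cong[where f = card])

text \<open>A change of measure: weighting a transcript by exp (-gain) turns its count over
  \<open>avoiding\<close> inputs into its count over \<open>all_sets\<close> inputs divided by
  2^k.\<close>

lemma sum_exp_gain_le: "(\<Sum>X\<in>Pi\<^sub>E {..<k} (avoiding \<omega>). exp (- gain \<omega> (transcript t X))) \<le> real num_inputs"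
proof -
  have "(\<Sum>X\<in>Pi\<^sub>E {..<k} (avoiding \<omega>). exp (- gain \<omega> (transcript t X)))
      = (\<Sum>\<tau>\<in>range (transcript t). real (\<Prod>i<k. hits (avoiding \<omega>) i \<tau>) * exp (- gain \<omega> \<tau>))"
    using finite_PiE_families[OF \<omega>] by (intro sum_over_transcripts)
  also have "\<dots> \<le> (\<Sum>\<tau>\<in>range (transcript t). real (\<Prod>i<k. hits (all_sets \<omega>) i \<tau>) * (1 / 2 ^ k))"
  proof (rule sum_mono)
    fix \<tau>
    show "real (\<Prod>i<k. hits (avoiding \<omega>) i \<tau>) * exp (- gain \<omega> \<tau>)
        \<le> real (\<Prod>i<k. hits (all_sets \<omega>) i \<tau>) * (1 / 2 ^ k)"
    \<comment> \<open>Transcripts that no \<open>avoiding\<close> input produces are lost on the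
      left, which is why only an inequality holds.\<close>
    proof (cases "\<exists>i<k. hits (avoiding \<omega>) i \<tau> = 0")
      case True
      then have "(\<Prod>i<k. hits (avoiding \<omega>) i \<tau>) = 0" by auto
      then show ?thesis by (simp only:) (simp add: prod_nonneg)
    next
      case False
      have pos: "hits (avoiding \<omega>) i \<tau> > 0" "hits (all_sets \<omega>) i \<tau> > 0" if "i < k" for i
        using False that hits_split[OF that, of \<tau>] by auto
      have f: "avoid_frac \<omega> i \<tau> > 0" if "i < k" for i using pos[OF that] unfolding avoid_frac_def by simp
      have "exp (- gain \<omega> \<tau>) = (\<Prod>i<k. exp (- ln (2 * avoid_frac \<omega> i \<tau>)))"
        unfolding gain_def by (simp add: exp_sum flip: sum_negf)
      then have "real (\<Prod>i<k. hits (avoiding \<omega>) i \<tau>) * exp (- gain \<omega> \<tau>)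
          = (\<Prod>i<k. real (hits (avoiding \<omega>) i \<tau>) * exp (- ln (2 * avoid_frac \<omega> i \<tau>)))"
        by (simp add: prod.distrib)
      also have "\<dots> = (\<Prod>i<k. real (hits (all_sets \<omega>) i \<tau>) * (1 / 2))"
      proof (rule prod.cong[OF refl])
        fix i assume "i \<in> {..<k}"
        then have i: "i < k" by simp
        show "real (hits (avoiding \<omega>) i \<tau>) * exp (- ln (2 * avoid_frac \<omega> i \<tau>)) = real (hits (all_sets \<omega>) i \<tau>) * (1 / 2)"
          using f[OF i] pos[OF i] by (simp add: exp_minus avoid_frac_def field_simps)
      qed
      also have "\<dots> = real (\<Prod>i<k. hits (all_sets \<omega>) i \<tau>) * (1 / 2 ^ k)"
        by (simp add: prod.distrib power_divide prod_dividef)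
      finally show ?thesis by simp
    qed
  qed
  also have "\<dots> = (\<Sum>X\<in>Pi\<^sub>E {..<k} (all_sets \<omega>). 1 / 2 ^ k)"
    using finite_PiE_families[OF \<omega>] by (intro sum_over_transcripts[symmetric])
  also have "\<dots> = real num_inputs" by (simp add: card_PiE_all_sets[OF \<omega>])
  finally show ?thesis .
qed

text \<open>The factor of player \<open>i\<close> in the likelihood ratio is the odds (1 - f_i) /
  f_i, to which \<open>ln_odds_ge\<close> applies.\<close>

lemma typical_hits:
  assumes X: "X \<in> Pi\<^sub>E {..<k} (avoiding \<omega>)" and typical: "typical \<omega> (transcript t X)"
  shows "exp (- (3/2)) * real (\<Prod>i<k. hits (avoiding \<omega>) i (transcript t X))
    \<le> real (\<Prod>i<k. hits (containing \<omega>) i (transcript t X))"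
proof -
  define \<tau> where "\<tau> = transcript t X"
  define e where "e i = - 2 * ln (2 * avoid_frac \<omega> i \<tau>) - 8 * (avoid_frac \<omega> i \<tau> - 1/2)\<^sup>2" for i
  have ratio: "real (hits (avoiding \<omega>) i \<tau>) * exp (e i) \<le> real (hits (containing \<omega>) i \<tau>)" if i: "i < k" for i
  proof -
    \<comment> \<open>The input \<open>X\<close> itself shows that the counts are positive, so the
      fractions are meaningful.\<close>
    have "X i \<in> {Y \<in> avoiding \<omega> i. consistent i t \<tau> Y}"
      using X i transcript_iff[of X \<tau>] by (auto simp: \<tau>_def)
    then have pos: "hits (avoiding \<omega>) i \<tau> > 0"
      unfolding hits_def using finite_families[OF \<omega> i] by (auto simp: card_gt_0_iff)
    have "(avoid_frac \<omega> i \<tau> - 1/2)\<^sup>2 \<le> spread \<omega> \<tau>"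
      unfolding spread_def using i by (intro member_le_sum) auto
    also have "\<dots> \<le> (1/4)\<^sup>2" using typical unfolding typical_def \<tau>_def by (simp add: power2_eq_square)
    finally have "(avoid_frac \<omega> i \<tau> - 1/2)\<^sup>2 \<le> (1/4)\<^sup>2" .
    then have f: "\<bar>avoid_frac \<omega> i \<tau> - 1/2\<bar> \<le> 1/4" by (simp add: abs_le_square_iff[symmetric])
    then have f': "avoid_frac \<omega> i \<tau> > 0" "avoid_frac \<omega> i \<tau> < 1" unfolding abs_le_iff by linarith+
    have "exp (e i) \<le> exp (ln ((1 - avoid_frac \<omega> i \<tau>) / avoid_frac \<omega> i \<tau>))"
      unfolding e_def using ln_odds_ge[OF f] by simp
    also have "\<dots> = (1 - avoid_frac \<omega> i \<tau>) / avoid_frac \<omega> i \<tau>" using f' by simp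
    also have "\<dots> = real (hits (containing \<omega>) i \<tau>) / real (hits (avoiding \<omega>) i \<tau>)"
    proof -
      have "(1 - a / (a + b)) / (a / (a + b)) = b / a" if "0 < a" "0 \<le> b" for a b :: real
      proof -
        have "1 - a / (a + b) = b / (a + b)" using that by (simp add: field_simps)
        then show ?thesis using that by simp
      qed
      then show ?thesis using pos unfolding avoid_frac_def hits_split[OF i] of_nat_add by simp
    qed
    finally show ?thesis using pos by (simp add: field_simps)
  qed
  \<comment> \<open>-2 * (1/2) - 8 * (1/16) = -3/2.\<close>
  have "- (3/2) \<le> (\<Sum>i<k. e i)"
  proof -
    have "(\<Sum>i<k. e i) = - 2 * gain \<omega> \<tau> - 8 * spread \<omega> \<tau>"
      unfolding e_def gain_def spread_def by (simp add: sum_subtractf sum_distrib_left sum_negf)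
    then show ?thesis using typical unfolding typical_def \<tau>_def by simp
  qed
  then have "exp (- (3/2)) \<le> (\<Prod>i<k. exp (e i))" by (simp flip: exp_sum)
  then have "exp (- (3/2)) * real (\<Prod>i<k. hits (avoiding \<omega>) i \<tau>)
      \<le> (\<Prod>i<k. exp (e i)) * real (\<Prod>i<k. hits (avoiding \<omega>) i \<tau>)"
    by (intro mult_right_mono) (auto simp: prod_nonneg)
  also have "\<dots> = (\<Prod>i<k. real (hits (avoiding \<omega>) i \<tau>) * exp (e i))" by (simp add: prod.distrib mult.commute)
  also have "\<dots> \<le> (\<Prod>i<k. real (hits (containing \<omega>) i \<tau>))" using ratio by (intro prod_mono) auto
  finally show ?thesis by (simp add: \<tau>_def)
qed

text \<open>Rejecting transcripts that are typical for answer 0 are almost as frequent for answer 1,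
  where rejecting is an error.\<close>

lemma card_rejecting_containing_ge:
  "exp (- (3/2)) * real (card {X \<in> Pi\<^sub>E {..<k} (avoiding \<omega>). typical \<omega> (transcript t X) \<and> \<not> run t X})
    \<le> real (card {X \<in> Pi\<^sub>E {..<k} (containing \<omega>). \<not> run t X})"
proof -
  let ?A = "Pi\<^sub>E {..<k} (avoiding \<omega>)" and ?C = "Pi\<^sub>E {..<k} (containing \<omega>)"
  let ?ok = "\<lambda>\<tau>. typical \<omega> \<tau> \<and> \<not> outcome t \<tau>"
  have "real (card {X \<in> ?A. typical \<omega> (transcript t X) \<and> \<not> run t X}) = (\<Sum>X\<in>?A. of_bool (?ok (transcript t X)))"
    using finite_PiE_families[OF \<omega>] by (simp add: run_eq_outcome of_bool_def flip: sum.inter_filter)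
  also have "\<dots> = (\<Sum>\<tau>\<in>range (transcript t). real (\<Prod>i<k. hits (avoiding \<omega>) i \<tau>) * of_bool (?ok \<tau>))"
    using finite_PiE_families[OF \<omega>] by (intro sum_over_transcripts)
  finally have "exp (- (3/2)) * real (card {X \<in> ?A. typical \<omega> (transcript t X) \<and> \<not> run t X})
      = (\<Sum>\<tau>\<in>range (transcript t). exp (- (3/2)) * real (\<Prod>i<k. hits (avoiding \<omega>) i \<tau>) * of_bool (?ok \<tau>))"
    by (simp add: sum_distrib_left mult.assoc)
  also have "\<dots> \<le> (\<Sum>\<tau>\<in>range (transcript t). real (\<Prod>i<k. hits (containing \<omega>) i \<tau>) * of_bool (\<not> outcome t \<tau>))"
  proof (rule sum_mono)
    fix \<tau>
    show "exp (- (3/2)) * real (\<Prod>i<k. hits (avoiding \<omega>) i \<tau>) * of_bool (?ok \<tau>)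
        \<le> real (\<Prod>i<k. hits (containing \<omega>) i \<tau>) * of_bool (\<not> outcome t \<tau>)"
    proof (cases "?ok \<tau> \<and> (\<exists>X\<in>?A. transcript t X = \<tau>)")
      case True
      then show ?thesis using typical_hits by (auto simp del: of_nat_prod)
    next
      case False
      then have "\<not> ?ok \<tau> \<or> {X \<in> ?A. transcript t X = \<tau>} = {}" by blast
      then have "\<not> ?ok \<tau> \<or> (\<Prod>i<k. hits (avoiding \<omega>) i \<tau>) = 0"
        by (metis card_transcript_fibre card.empty)
      then show ?thesis
      proof
        assume "(\<Prod>i<k. hits (avoiding \<omega>) i \<tau>) = 0"
        then show ?thesis by (simp only:) (simp add: prod_nonneg)
      qed (simp add: prod_nonneg)
    qed
  qed
  also have "\<dots> = (\<Sum>X\<in>?C. of_bool (\<not> outcome t (transcript t X)))"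
    using finite_PiE_families[OF \<omega>] by (intro sum_over_transcripts[symmetric])
  also have "\<dots> = real (card {X \<in> ?C. \<not> run t X})"
    using finite_PiE_families[OF \<omega>] by (simp add: run_eq_outcome of_bool_def flip: sum.inter_filter)
  finally show ?thesis .
qed

text \<open>Markov's inequality for the two nonnegative quantities gain + exp (-gain) - 1 and
  spread. The exponential and the -1 together sum to at most 0 by
  \<open>sum_exp_gain_le\<close>.\<close>

lemma card_atypical_le:
  "real (card {X \<in> Pi\<^sub>E {..<k} (avoiding \<omega>). \<not> typical \<omega> (transcript t X)})
    \<le> 16 * (\<Sum>X\<in>Pi\<^sub>E {..<k} (avoiding \<omega>). gain \<omega> (transcript t X))
      + 16 * (\<Sum>X\<in>Pi\<^sub>E {..<k} (avoiding \<omega>). spread \<omega> (transcript t X))"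
proof -
  let ?A = "Pi\<^sub>E {..<k} (avoiding \<omega>)"
  have "real (card {X \<in> ?A. \<not> typical \<omega> (transcript t X)}) = (\<Sum>X\<in>?A. of_bool (\<not> typical \<omega> (transcript t X)))"
    using finite_PiE_families[OF \<omega>] by (simp add: of_bool_def flip: sum.inter_filter)
  also have "\<dots> \<le> (\<Sum>X\<in>?A. 16 * (gain \<omega> (transcript t X) + exp (- gain \<omega> (transcript t X)) - 1)
      + 16 * spread \<omega> (transcript t X))"
  proof (rule sum_mono)
    fix X
    have "0 \<le> spread \<omega> (transcript t X)" unfolding spread_def by (intro sum_nonneg) auto
    moreover have "0 \<le> gain \<omega> (transcript t X) + exp (- gain \<omega> (transcript t X)) - 1"
      using exp_ge_add_one_self[of "- gain \<omega> (transcript t X)"] by simp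
    ultimately show "of_bool (\<not> typical \<omega> (transcript t X))
      \<le> 16 * (gain \<omega> (transcript t X) + exp (- gain \<omega> (transcript t X)) - 1) + 16 * spread \<omega> (transcript t X)"
      using deviation_ge[of "gain \<omega> (transcript t X)"] unfolding typical_def by (auto simp: not_less)
  qed
  also have "\<dots> = 16 * (\<Sum>X\<in>?A. gain \<omega> (transcript t X))
      + 16 * ((\<Sum>X\<in>?A. exp (- gain \<omega> (transcript t X))) - real num_inputs)
      + 16 * (\<Sum>X\<in>?A. spread \<omega> (transcript t X))"
    by (simp add: sum.distrib sum_subtractf sum_distrib_left card_PiE_avoiding[OF \<omega>] algebra_simps)
  finally show ?thesis using sum_exp_gain_le by simp
qed

end

lemma cost_ge:
  assumes err: "(\<Sum>\<omega>\<in>configs. real (card {X \<in> Pi\<^sub>E {..<k} (avoiding \<omega>). run t X})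
      + real (card {X \<in> Pi\<^sub>E {..<k} (containing \<omega>). \<not> run t X})) \<le> 2/100 * (real (card configs) * real num_inputs)"
  shows "1/100 \<le> cost"
proof -
  define V where "V = real (card configs) * real num_inputs"
  have V: "V > 0" unfolding V_def
    using finite_configs configs_nonempty num_inputs_pos by (simp add: card_gt_0_iff)
  define e0 where "e0 \<omega> = real (card {X \<in> Pi\<^sub>E {..<k} (avoiding \<omega>). run t X})" for \<omega>
  define e1 where "e1 \<omega> = real (card {X \<in> Pi\<^sub>E {..<k} (containing \<omega>). \<not> run t X})" for \<omega>
  define G where "G \<omega> = (\<Sum>X\<in>Pi\<^sub>E {..<k} (avoiding \<omega>). gain \<omega> (transcript t X))" for \<omega>
  define D where "D \<omega> = (\<Sum>X\<in>Pi\<^sub>E {..<k} (avoiding \<omega>). spread \<omega> (transcript t X))" for \<omega>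
  define q where "q = exp (- (3/2) :: real)"
  \<comment> \<open>(9/16)^3 is about 0.178.\<close>
  have q: "17/100 \<le> q"
  proof -
    have "(9/16 :: real) ^ 3 \<le> exp (- (1/2)) ^ 3" using exp_neg_half_ge by (intro power_mono) auto
    also have "\<dots> = q" unfolding q_def by (simp flip: exp_of_nat_mult)
    finally show ?thesis by (simp add: power3_eq_cube)
  qed
  have step: "q * (real num_inputs - e0 \<omega> - 16 * G \<omega> - 16 * D \<omega>) \<le> e1 \<omega>" if \<omega>: "\<omega> \<in> configs" for \<omega>
  proof -
    let ?A = "Pi\<^sub>E {..<k} (avoiding \<omega>)"
    have fin: "finite ?A" using finite_PiE_families[OF \<omega>] by simp
    have "card ?A \<le> card ({X \<in> ?A. typical \<omega> (transcript t X) \<and> \<not> run t X}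
        \<union> ({X \<in> ?A. run t X} \<union> {X \<in> ?A. \<not> typical \<omega> (transcript t X)}))"
      using fin by (intro card_mono) auto
    also have "\<dots> \<le> card {X \<in> ?A. typical \<omega> (transcript t X) \<and> \<not> run t X}
        + (card {X \<in> ?A. run t X} + card {X \<in> ?A. \<not> typical \<omega> (transcript t X)})"
      by (intro order_trans[OF card_Un_le] add_left_mono card_Un_le)
    finally have "real num_inputs \<le> real (card {X \<in> ?A. typical \<omega> (transcript t X) \<and> \<not> run t X})
        + (e0 \<omega> + real (card {X \<in> ?A. \<not> typical \<omega> (transcript t X)}))"
      unfolding card_PiE_avoiding[OF \<omega>] e0_def by linarith
    then have "real num_inputs - e0 \<omega> - 16 * G \<omega> - 16 * D \<omega>
        \<le> real (card {X \<in> ?A. typical \<omega> (transcript t X) \<and> \<not> run t X})"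
      using card_atypical_le[OF \<omega>] unfolding G_def D_def by linarith
    then have "q * (real num_inputs - e0 \<omega> - 16 * G \<omega> - 16 * D \<omega>)
        \<le> q * real (card {X \<in> ?A. typical \<omega> (transcript t X) \<and> \<not> run t X})"
      using q by (intro mult_left_mono) auto
    then show ?thesis using card_rejecting_containing_ge[OF \<omega>] unfolding q_def e1_def by linarith
  qed
  have "q * (V - sum e0 configs - 16 * sum G configs - 16 * sum D configs)
      = (\<Sum>\<omega>\<in>configs. q * (real num_inputs - e0 \<omega> - 16 * G \<omega> - 16 * D \<omega>))"
    unfolding V_def by (simp add: sum_subtractf flip: sum_distrib_left)
  also have "\<dots> \<le> sum e1 configs" by (intro sum_mono step)
  finally have *: "q * (V - sum e0 configs - 16 * sum G configs - 16 * sum D configs) \<le> sum e1 configs" .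
  have nonneg: "0 \<le> sum e0 configs" "0 \<le> sum e1 configs" unfolding e0_def e1_def by (auto intro: sum_nonneg)
  have err': "sum e0 configs + sum e1 configs \<le> 2/100 * V"
    using err unfolding e0_def e1_def V_def by (simp add: sum.distrib)
  have GD: "sum G configs \<le> V * cost" "sum D configs \<le> 3 * (V * cost)"
    using sum_gain_le sum_spread_le unfolding G_def D_def V_def by auto
  show ?thesis
  proof (rule ccontr)
    assume "\<not> ?thesis"
    then have "V * cost \<le> V * (1/100)" using V by (intro mult_left_mono) auto
    \<comment> \<open>At most 2/100 of the inputs err, and at most (16 + 48)/100 are atypical. The
      remaining 34/100 force more than 5/100 errors on the other answer, against the allowed
      2/100.\<close>
    then have "34/100 * V \<le> V - sum e0 configs - 16 * sum G configs - 16 * sum D configs"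
      using GD err' nonneg by linarith
    then have "17/100 * (34/100 * V) \<le> q * (V - sum e0 configs - 16 * sum G configs - 16 * sum D configs)"
      using q V by (intro mult_mono) auto
    then show False using * err' nonneg V by linarith
  qed
qed

end

theorem mainTheorem2:
  shows "\<exists>c::real. c > 0 \<and>
    (\<forall>k n (s :: nat \<Rightarrow> nat) (cb :: nat \<Rightarrow> nat) (P :: protocol pmf).
       k \<ge> 2 \<longrightarrow> n \<ge> 1 \<longrightarrow> (\<forall>i<k. s i \<ge> 1) \<longrightarrow>
       real (\<Sum>i<k. s i) \<le> real n / 2 \<longrightarrow>
       bounded_randomized k cb P \<longrightarrow> solves_UDISJ k n s P \<longrightarrow>
       (\<Sum>i<k. real (cb i) / real (s i)) \<ge> c)"
proof (intro exI[of _ "1/100"] conjI allI impI)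
  fix k n and s cb :: "nat \<Rightarrow> nat" and P
  assume k: "k \<ge> 2" and s: "\<forall>i<k. s i \<ge> 1" and room: "real (\<Sum>i<k. s i) \<le> real n / 2"
    and bounded: "bounded_randomized k cb P" and solves: "solves_UDISJ k n s P"
  have "2 * (\<Sum>i<k. s i) \<le> n" using room by linarith
  then interpret hard_inputs k n s by unfold_locales (use k s in auto)
  obtain t where t: "t \<in> set_pmf P" and err:
    "(\<Sum>\<omega>\<in>configs. real (card {X \<in> Pi\<^sub>E {..<k} (avoiding \<omega>). run t X})
      + real (card {X \<in> Pi\<^sub>E {..<k} (containing \<omega>). \<not> run t X})) \<le> 2/100 * (real (card configs) * real num_inputs)"
    using exists_good_protocol[OF solves] by blast
  interpret hard_protocol k n s t cb
    by unfold_locales (use bounded t in \<open>auto simp: bounded_randomized_def\<close>)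
  show "(\<Sum>i<k. real (cb i) / real (s i)) \<ge> 1/100"
    using cost_ge[OF err] unfolding cost_def .
qed simp

end
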